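(* For every integer $k\ge1$ and every complex $q$ with $|q|<1$, $$\sum_{\substack{n_k\ge\cdots\ge n_1\ge0\\ l_k\ge\cdots\ge l_1\ge0}}\frac{q^{n_1^2+\cdots+n_k^2+l_1^2+\cdots+l_k^2+n_1+\cdots+n_k+l_1+\cdots+l_k}}{(q;q)_{n_k-n_{k-1}}\cdots(q;q)_{n_2-n_1}\,(q;q)_{l_k-l_{k-1}}\cdots(q;q)_{l_2-l_1}}\cdot\frac{1}{(q^2;q)_{n_1+l_1}(q;q)_{n_1}(q;q)_{l_1}}$$ $$=\frac{1}{(q^2;q)_\infty}\prod_{\substack{m\ge1\\ m\not\equiv0,\pm1\ (\mathrm{mod}\ 4k+3)}}\frac{1}{1-q^m}.$$
   Context: Notation: $(x;q)_n=\prod_{j=0}^{n-1}(1-xq^j)$ for integers $n\ge0$, and $(x;q)_\infty=\prod_{j\ge0}(1-xq^j)$. The sum is over integers $n_i,l_i$ ($1\le i\le k$); for $k=1$ the products of difference factors are empty (equal to 1). *)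

theory Defs
  imports "HOL-Analysis.Analysis" "HOL-Number_Theory.Cong"
begin

definition qpoch :: "complex \<Rightarrow> complex \<Rightarrow> nat \<Rightarrow> complex" where
  "qpoch x q n = (\<Prod>j<n. 1 - x * q ^ j)"

definition qpoch_inf :: "complex \<Rightarrow> complex \<Rightarrow> complex" where
  "qpoch_inf x q = (\<Prod>j. 1 - x * q ^ j)"

text \<open>A tuple \<open>(n\<^sub>1, \<dots>, n\<^sub>k)\<close> with \<open>n\<^sub>k \<ge> \<dots> \<ge> n\<^sub>1 \<ge> 0\<close> is a function on the naturals that is
  monotone on \<open>{1..k}\<close>; extensionality outside \<open>{1..k}\<close> makes each tuple occur exactly once.\<close>

definition tuples :: "nat \<Rightarrow> (nat \<Rightarrow> nat) set" where
  "tuples k = {n \<in> extensional {1..k}. mono_on {1..k} n}"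

definition summand :: "nat \<Rightarrow> complex \<Rightarrow> (nat \<Rightarrow> nat) \<Rightarrow> (nat \<Rightarrow> nat) \<Rightarrow> complex" where
  "summand k q n l =
     q ^ ((\<Sum>i=1..k. (n i)\<^sup>2) + (\<Sum>i=1..k. (l i)\<^sup>2) + (\<Sum>i=1..k. n i) + (\<Sum>i=1..k. l i))
       / ((\<Prod>i\<in>{1..<k}. qpoch q q (n (i + 1) - n i)) * (\<Prod>i\<in>{1..<k}. qpoch q q (l (i + 1) - l i)))
     * (1 / (qpoch (q\<^sup>2) q (n 1 + l 1) * qpoch q q (n 1) * qpoch q q (l 1)))"

definition product_factor :: "nat \<Rightarrow> complex \<Rightarrow> nat \<Rightarrow> complex" where
  "product_factor k q m =
     (if m \<ge> 1 \<and> \<not> [int m = 0] (mod (4 * int k + 3)) \<and> \<not> [int m = 1] (mod (4 * int k + 3))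
           \<and> \<not> [int m = - 1] (mod (4 * int k + 3))
      then 1 / (1 - q ^ m) else 1)"

text \<open>For \<open>norm q < 1\<close> both kinds of infinite product converge, so \<open>prodinf\<close> is never an unspecified value here.\<close>

lemma convergent_prod_qpoch:
  assumes "norm q < 1"
  shows "convergent_prod (\<lambda>j. 1 - x * q ^ j :: complex)"
proof -
  have "summable (\<lambda>j. norm (1 - x * q ^ j - 1))"
    using assms by (simp add: norm_mult norm_power summable_mult summable_geometric)
  then show ?thesis
    by (intro abs_convergent_prod_imp_convergent_prod summable_imp_abs_convergent_prod)
qed

lemma convergent_prod_product_factor:
  assumes "norm q < 1"
  shows "convergent_prod (product_factor k q)"
proof -
  let ?g = "\<lambda>m. inverse (product_factor k q m)"
  have "norm (?g m - 1) \<le> norm q ^ m" for m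
    by (simp add: product_factor_def norm_power)
  then have "summable (\<lambda>m. norm (?g m - 1))"
    using assms by (intro summable_comparison_test[OF _ summable_geometric[of "norm q"]]) auto
  then have "convergent_prod ?g"
    by (intro abs_convergent_prod_imp_convergent_prod summable_imp_abs_convergent_prod)
  then have "convergent_prod (\<lambda>m. inverse (?g m))"
    by (rule convergent_prod_inverse)
  then show ?thesis by simp
qed

end

theory Submission
  imports Defs
begin

text \<open>The sum factors through the double Bailey pair relative to \<open>q\<close>
  \[ \frac{1-q}{(q;q)_{n+l+1}(q;q)_n(q;q)_l}
     = (1-q)\sum_{r\ge0} \frac{a_r}{(q;q)_{n-r}(q;q)_{n+r+1}(q;q)_{l-r}(q;q)_{l+r+1}},
     \qquad a_r=(-1)^r q^{(3r^2+r)/2}(1-q^{2r+1}), \]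
  which is diagonal in \<open>r\<close>. For fixed \<open>r\<close> the sums over the \<open>n\<^sub>i\<close> and over the \<open>l\<^sub>i\<close> separate, and iterating the
  Bailey lemma (a q-Vandermonde sum) evaluates each of them to \<open>q\<close> to the power \<open>k (r\<^sup>2 + r)\<close> divided by the
  infinite product \<open>(q;q)\<close>. What remains is a theta series of modulus \<open>4k + 3\<close>, which the
  Jacobi triple product evaluates.\<close>

subsection \<open>q-Pochhammer symbols and the q-Vandermonde sum\<close>

text \<open>For fixed r the vector \<open>bailey_kernel q n r\<close> (in n) is an eigenvector, with
  eigenvalue q^(r^2+r), of the triangular matrix with entries q^(n^2+n) / (q;q)_(N-n). That is why a
  chain of any length collapses one index at a time; only the sum over the largest index is
  infinite, and it produces the factor 1/(q;q)_inf. The two chains together give q^(2k(r^2+r)) =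
  q^(4k r(r+1)/2), while a_r q^r contributes 3 r(r+1)/2 to the exponent: hence the modulus 4k + 3.
  The same kernel is a q-binomial coefficient [2n+1, n-r] divided by (q;q)_(2n+1), so it also
  carries a finite form of the triple product. The analytic obstacle is exchanging the sum over r
  with the sums over both tuples. It is met by absolute convergence: the kernel is bounded uniformly
  in n and r, the tuple weights are dominated by geometric ones, and a_r is O(|q|^r).\<close>

lemma one_minus_power_nonzero:
  fixes q :: complex
  assumes "norm q < 1" "m > 0"
  shows "1 - q ^ m \<noteq> 0"
proof
  assume "1 - q ^ m = 0"
  then have "norm q ^ m = 1" by (metis eq_iff_diff_eq_0 norm_one norm_power)
  with assms show False by (metis less_irrefl norm_ge_zero power_less_one_iff)
qed

lemma qpoch_0 [simp]: "qpoch x q 0 = 1"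
  by (simp add: qpoch_def)

lemma qpoch_Suc: "qpoch x q (Suc n) = qpoch x q n * (1 - x * q ^ n)"
  by (simp add: qpoch_def)

lemma qpoch_q_Suc: "qpoch q q (Suc n) = qpoch q q n * (1 - q ^ Suc n)"
  by (simp add: qpoch_Suc)

lemma qpoch_q_nonzero:
  assumes "norm q < 1"
  shows "qpoch q q n \<noteq> 0"
  using one_minus_power_nonzero[OF assms, of "Suc _"] by (simp add: qpoch_def)

lemma qpoch_shift: "qpoch x q (Suc n) = (1 - x) * qpoch (x * q) q n"
  unfolding qpoch_def prod.lessThan_Suc_shift by (simp add: mult.assoc)

lemma qpoch_tendsto:
  assumes "norm q < 1"
  shows "qpoch x q \<longlonglongrightarrow> qpoch_inf x q"
proof -
  have "(\<lambda>n. \<Prod>j<n. 1 - x * q ^ j) \<longlonglongrightarrow> qpoch_inf x q"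
    unfolding qpoch_inf_def LIMSEQ_lessThan_iff_atMost
    by (rule convergent_prod_LIMSEQ[OF convergent_prod_qpoch[OF assms]])
  then show ?thesis by (simp add: qpoch_def[abs_def])
qed

lemma qpoch_inf_q_nonzero:
  assumes "norm q < 1"
  shows "qpoch_inf q q \<noteq> 0"
  unfolding qpoch_inf_def
  using one_minus_power_nonzero[OF assms, of "Suc _"]
  by (intro prodinf_nonzero convergent_prod_qpoch assms) auto

text \<open>A convergent sequence with non-zero limit has bounded reciprocals here. The constant
  feeds the majorants for Tannery's theorem and for absolute summability below.\<close>

lemma inverse_qpoch_q_bounded:
  assumes "norm q < 1"
  obtains C where "C > 0" "\<And>n. norm (1 / qpoch q q n) \<le> C"
proof -
  have "(\<lambda>n. 1 / qpoch q q n) \<longlonglongrightarrow> 1 / qpoch_inf q q"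
    by (intro tendsto_intros qpoch_tendsto qpoch_inf_q_nonzero assms)
  then have "Bseq (\<lambda>n. 1 / qpoch q q n)"
    by (intro convergent_imp_Bseq convergentI)
  then show thesis using that by (auto simp: Bseq_def)
qed

text \<open>Split 1 - q^(M+1) = (1 - q^(M+1-m)) + q^(M+1-m) (1 - q^m). The first part cancels the
  last factor of (q;q)_(M+1-m) and leaves the sum for M with the same c; the second cancels the last
  factor of (q;q)_m and, after a shift of m, leaves the sum for M with c + 1. Hence the induction
  generalizes over c.\<close>

lemma q_vandermonde:
  assumes q: "norm q < 1"
  shows "(\<Sum>m\<le>M. q ^ (m * (m + c)) / (qpoch q q m * qpoch q q (M - m) * qpoch q q (m + c)))
           = 1 / (qpoch q q M * qpoch q q (M + c))"
proof (induction M arbitrary: c)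
  case 0
  show ?case by simp
next
  case (Suc M)
  note nz = qpoch_q_nonzero[OF q] one_minus_power_nonzero[OF q]
  define t where "t m = q ^ (m * (m + c)) / (qpoch q q m * qpoch q q (Suc M - m) * qpoch q q (m + c))" for m
  have "(1 - q ^ Suc M) * (\<Sum>m\<le>Suc M. t m)
      = (\<Sum>m\<le>Suc M. (1 - q ^ (Suc M - m)) * t m) + (\<Sum>m\<le>Suc M. q ^ (Suc M - m) * (1 - q ^ m) * t m)"
    unfolding sum_distrib_left sum.distrib[symmetric]
  proof (intro sum.cong refl)
    fix m assume "m \<in> {..Suc M}"
    then have "q ^ Suc M = q ^ (Suc M - m) * q ^ m"
      by (metis atMost_iff le_add_diff_inverse2 power_add)
    then show "(1 - q ^ Suc M) * t m = (1 - q ^ (Suc M - m)) * t m + q ^ (Suc M - m) * (1 - q ^ m) * t m"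
      by (simp only:) (simp add: algebra_simps)
  qed
  also have "(\<Sum>m\<le>Suc M. (1 - q ^ (Suc M - m)) * t m)
      = (\<Sum>m\<le>M. q ^ (m * (m + c)) / (qpoch q q m * qpoch q q (M - m) * qpoch q q (m + c)))"
  proof -
    have "(1 - q ^ (Suc M - m)) * t m = q ^ (m * (m + c)) / (qpoch q q m * qpoch q q (M - m) * qpoch q q (m + c))"
      if "m \<le> M" for m
      using that nz(2)[of "Suc (M - m)"] nz(1)
      by (simp add: t_def Suc_diff_le qpoch_q_Suc del: power_Suc)
    then show ?thesis by simp
  qed
  also have "\<dots> = 1 / (qpoch q q M * qpoch q q (M + c))" by (rule Suc)
  also have "(\<Sum>m\<le>Suc M. q ^ (Suc M - m) * (1 - q ^ m) * t m)
      = q ^ (Suc M + c) * (\<Sum>m\<le>M. q ^ (m * (m + Suc c)) / (qpoch q q m * qpoch q q (M - m) * qpoch q q (m + Suc c)))"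
  proof -
    have "q ^ (M - m) * (1 - q ^ Suc m) * t (Suc m)
        = q ^ (Suc M + c) * (q ^ (m * (m + Suc c)) / (qpoch q q m * qpoch q q (M - m) * qpoch q q (m + Suc c)))"
      if "m \<le> M" for m
    proof -
      have "q ^ (M - m) * q ^ (Suc m * (Suc m + c)) = q ^ (Suc M + c) * q ^ (m * (m + Suc c))"
        unfolding power_add[symmetric] using that
        by (intro arg_cong[where f = "(^) q"]) (simp add: algebra_simps)
      moreover have "(1 - q ^ Suc m) * t (Suc m) = q ^ (Suc m * (Suc m + c)) / (qpoch q q m * qpoch q q (M - m) * qpoch q q (m + Suc c))"
        using nz(2)[of "Suc m"] nz(1)
        by (simp add: t_def qpoch_q_Suc[of q m] del: power_Suc)
      ultimately show ?thesis by (simp add: mult.assoc)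
    qed
    then show ?thesis
      by (subst sum.atMost_Suc_shift) (simp add: sum_distrib_left)
  qed
  also have "(\<Sum>m\<le>M. q ^ (m * (m + Suc c)) / (qpoch q q m * qpoch q q (M - m) * qpoch q q (m + Suc c)))
      = 1 / (qpoch q q M * qpoch q q (M + Suc c))" by (rule Suc)
  also have "1 / (qpoch q q M * qpoch q q (M + c)) + q ^ (Suc M + c) * (1 / (qpoch q q M * qpoch q q (M + Suc c)))
      = 1 / (qpoch q q M * qpoch q q (Suc M + c))"
    using nz(1)[of M] nz(1)[of "M + c"] nz(2)[of "Suc (M + c)"]
    by (simp add: qpoch_q_Suc[of q "M + c"] field_simps del: power_Suc)
  also have "\<dots> = (1 - q ^ Suc M) * (1 / (qpoch q q (Suc M) * qpoch q q (Suc M + c)))"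
    using nz(2)[of "Suc M"] by (simp add: qpoch_q_Suc[of q M] del: power_Suc)
  finally have "(1 - q ^ Suc M) * (\<Sum>m\<le>Suc M. t m) = \<dots>" .
  then show ?case
    unfolding t_def by (rule mult_left_cancel[OF nz(2)[OF zero_less_Suc], THEN iffD1])
qed

lemma power_mult_summable:
  fixes x :: real
  assumes "0 \<le> x" "x < 1"
  shows "summable (\<lambda>m. x ^ (m * (m + c)))"
proof (rule summable_comparison_test)
  show "\<exists>N. \<forall>m\<ge>N. norm (x ^ (m * (m + c))) \<le> x ^ m"
  proof (intro exI allI impI)
    fix m :: nat
    have "m \<le> m * (m + c)" by (cases m) auto
    then show "norm (x ^ (m * (m + c))) \<le> x ^ m"
      using assms by (simp add: power_decreasing)
  qed
qed (use assms in \<open>simp add: summable_geometric\<close>)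

text \<open>Let M tend to infinity in \<open>q_vandermonde\<close>: the terms tend to b_m / P and
  the right side to 1 / P^2, so one factor P cancels.\<close>

lemma q_vandermonde_inf:
  assumes q: "norm q < 1"
  shows "summable (\<lambda>m. norm (q ^ (m * (m + c)) / (qpoch q q m * qpoch q q (m + c))))"
    and "(\<Sum>m. q ^ (m * (m + c)) / (qpoch q q m * qpoch q q (m + c))) = 1 / qpoch_inf q q"
proof -
  obtain C where C: "C > 0" "\<And>n. norm (1 / qpoch q q n) \<le> C"
    using inverse_qpoch_q_bounded[OF q] by blast
  define P where "P = qpoch_inf q q"
  have P: "P \<noteq> 0" unfolding P_def by (rule qpoch_inf_q_nonzero[OF q])
  have D: "qpoch q q \<longlonglongrightarrow> P" unfolding P_def by (rule qpoch_tendsto[OF q])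
  define b where "b m = q ^ (m * (m + c)) / (qpoch q q m * qpoch q q (m + c))" for m
  \<comment> \<open>Extending the finite sum by 0 beyond M gives series over a fixed index set, the
    form in which dominated convergence applies.\<close>
  define a where "a m M = (if m \<le> M then b m / qpoch q q (M - m) else 0)" for m M
  have b_le: "norm (b m) \<le> C * C * norm q ^ (m * (m + c))" for m
  proof -
    have "norm (b m) = norm q ^ (m * (m + c)) * (norm (1 / qpoch q q m) * norm (1 / qpoch q q (m + c)))"
      by (simp add: b_def norm_divide norm_mult norm_power)
    also have "\<dots> \<le> norm q ^ (m * (m + c)) * (C * C)"
      using C by (intro mult_left_mono mult_mono) (auto intro: less_imp_le)
    finally show ?thesis by (simp add: mult_ac)
  qed
  have sm: "summable (\<lambda>m. K * norm q ^ (m * (m + c)))" for K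
    using q by (intro summable_mult power_mult_summable) auto
  show "summable (\<lambda>m. norm (q ^ (m * (m + c)) / (qpoch q q m * qpoch q q (m + c))))"
    using b_le unfolding b_def
    by (intro summable_comparison_test[OF _ sm[of "C * C"]]) auto
  have "(\<lambda>M. \<Sum>m. a m M) \<longlonglongrightarrow> (\<Sum>m. b m / P)"
  proof (rule tannerys_theorem[THEN conjunct2, THEN conjunct2])
    show "a m \<longlonglongrightarrow> b m / P" for m
    proof -
      have "(\<lambda>M. b m / qpoch q q M) \<longlonglongrightarrow> b m / P"
        by (intro tendsto_intros D P)
      then have "(\<lambda>M. a m (M + m)) \<longlonglongrightarrow> b m / P" by (simp add: a_def)
      then show ?thesis by (rule LIMSEQ_offset)
    qed
    show "\<forall>\<^sub>F (m, M) in sequentially \<times>\<^sub>F sequentially. norm (a m M) \<le> C * C * C * norm q ^ (m * (m + c))"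
    proof (intro always_eventually allI, clarify)
      fix m M
      have "norm (b m) * norm (1 / qpoch q q (M - m)) \<le> (C * C * norm q ^ (m * (m + c))) * C"
        using b_le C by (intro mult_mono) auto
      then show "norm (a m M) \<le> C * C * C * norm q ^ (m * (m + c))"
        using C(1) by (auto simp: a_def norm_divide mult_ac)
    qed
  qed (rule sm, simp)
  moreover have "(\<lambda>M. \<Sum>m. a m M) = (\<lambda>M. 1 / (qpoch q q M * qpoch q q (M + c)))"
  proof
    fix M
    have "(\<Sum>m. a m M) = (\<Sum>m\<le>M. a m M)"
      by (rule suminf_finite) (auto simp: a_def)
    also have "\<dots> = 1 / (qpoch q q M * qpoch q q (M + c))"
      unfolding q_vandermonde[OF q, symmetric]
      by (intro sum.cong) (auto simp: a_def b_def)
    finally show "(\<Sum>m. a m M) = 1 / (qpoch q q M * qpoch q q (M + c))" .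
  qed
  moreover have "(\<lambda>M. 1 / (qpoch q q M * qpoch q q (M + c))) \<longlonglongrightarrow> 1 / (P * P)"
    using P by (intro tendsto_intros D LIMSEQ_ignore_initial_segment) auto
  ultimately have "(\<Sum>m. b m / P) = 1 / (P * P)"
    using LIMSEQ_unique by metis
  moreover have "(\<Sum>m. b m / P) = (\<Sum>m. b m) / P"
    by (intro suminf_divide summable_comparison_test[OF _ sm[of "C * C"]])
       (use b_le in auto)
  ultimately show "(\<Sum>m. q ^ (m * (m + c)) / (qpoch q q m * qpoch q q (m + c))) = 1 / qpoch_inf q q"
    unfolding b_def[symmetric] P_def[symmetric] using P by (simp add: divide_eq_eq)
qed

subsection \<open>Bailey pairs relative to q\<close>

text \<open>This is \<open>1 / (q;q)\<^bsub>n-r\<^esub>\<close> with the convention that it vanishes for \<open>n < r\<close>.\<close>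

definition inverse_qpoch_diff :: "complex \<Rightarrow> nat \<Rightarrow> nat \<Rightarrow> complex" where
  "inverse_qpoch_diff q n r = (if r \<le> n then 1 / qpoch q q (n - r) else 0)"

text \<open>Up to the constant factor \<open>1 - q\<close>, the matrix \<open>1 / ((q;q)\<^bsub>n-r\<^esub> (a q;q)\<^bsub>n+r\<^esub>)\<close> that defines Bailey pairs
  relative to \<open>a = q\<close>.\<close>

definition bailey_kernel :: "complex \<Rightarrow> nat \<Rightarrow> nat \<Rightarrow> complex" where
  "bailey_kernel q n r = inverse_qpoch_diff q n r / qpoch q q (n + r + 1)"

text \<open>The \<open>div\<close> is exact, since r (3r + 1) is even; the exponents are generalized
  pentagonal numbers.\<close>

definition bailey_coeff :: "complex \<Rightarrow> nat \<Rightarrow> complex" where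
  "bailey_coeff q r = (- 1) ^ r * q ^ ((3 * r\<^sup>2 + r) div 2) * (1 - q ^ (2 * r + 1))"

lemma inverse_qpoch_diff_Suc_Suc [simp]:
  "inverse_qpoch_diff q (Suc n) (Suc r) = inverse_qpoch_diff q n r"
  by (simp add: inverse_qpoch_diff_def)

text \<open>The boundary r = n + 1 is included on purpose: both sides vanish there because 1 - q^0 =
  0. This lets the certificate be checked without separate boundary cases.\<close>

lemma inverse_qpoch_diff_Suc:
  assumes "norm q < 1" "r \<le> Suc n"
  shows "inverse_qpoch_diff q n r = (1 - q ^ (Suc n - r)) * inverse_qpoch_diff q (Suc n) r"
proof (cases "r = Suc n")
  case False
  with assms(2) have "r \<le> n" by simp
  then show ?thesis
    using one_minus_power_nonzero[OF assms(1), of "Suc (n - r)"]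
    by (simp add: inverse_qpoch_diff_def Suc_diff_le qpoch_q_Suc del: power_Suc)
qed (simp add: inverse_qpoch_diff_def)

lemma inverse_qpoch_diff_Suc_right:
  assumes "norm q < 1" "r \<le> n"
  shows "inverse_qpoch_diff q n (Suc r) = (1 - q ^ (n - r)) * inverse_qpoch_diff q n r"
  using inverse_qpoch_diff_Suc[OF assms(1), of "Suc r" n] assms(2) by simp

lemma inverse_qpoch_q_pred:
  assumes "norm q < 1"
  shows "1 / qpoch q q n = (1 - q ^ Suc n) * (1 / qpoch q q (Suc n))"
  using one_minus_power_nonzero[OF assms, of "Suc n"] by (simp add: qpoch_q_Suc del: power_Suc)

lemma bailey_kernel_eq_0: "n < r \<Longrightarrow> bailey_kernel q n r = 0"
  by (simp add: bailey_kernel_def inverse_qpoch_diff_def)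

text \<open>With the next lemma, this expresses the exponents of coefficient and certificate, at r
  and at r + 1, through (3r^2 - r)/2, so that they share one power of q.\<close>

lemma bailey_coeff_exponent:
  "(3 * (Suc r)\<^sup>2 - Suc r) div 2 = (3 * r\<^sup>2 + r) div 2 + 2 * r + (1::nat)"
proof -
  have "3 * (Suc r)\<^sup>2 - Suc r = (3 * r\<^sup>2 + r) + 2 * (2 * r + 1)"
    by (simp add: power2_eq_square)
  then show ?thesis by simp
qed

lemma bailey_coeff_exponent':
  "(3 * r\<^sup>2 + r) div 2 = (3 * r\<^sup>2 - r) div 2 + (r::nat)"
proof -
  have "r \<le> 3 * r\<^sup>2" by (cases r) (auto simp: power2_eq_square)
  then have "3 * r\<^sup>2 + r = (3 * r\<^sup>2 - r) + 2 * r" by simp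
  then have "(3 * r\<^sup>2 + r) div 2 = ((3 * r\<^sup>2 - r) + 2 * r) div 2" by (rule arg_cong)
  then show ?thesis by (simp only: div_mult_self2 zero_neq_numeral not_False_eq_True add.commute)
qed

text \<open>The q-WZ certificate for the recurrence in \<open>n\<close> of the sum in \<open>bailey_unit_pair\<close> below, a limiting
  case of the terminating very-well-poised \<open>\<^sub>6\<phi>\<^sub>5\<close> sum.\<close>

definition bailey_cert :: "complex \<Rightarrow> nat \<Rightarrow> nat \<Rightarrow> nat \<Rightarrow> complex" where
  "bailey_cert q l n r = (- 1) ^ r * q ^ (n + 1 + (3 * r\<^sup>2 - r) div 2) * (1 - q ^ r)
     * inverse_qpoch_diff q (Suc n) r * (1 / qpoch q q (n + r + 1))
     * inverse_qpoch_diff q l r * (1 / qpoch q q (l + r))"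

text \<open>Each reciprocal Pochhammer symbol is a polynomial multiple of the one with the largest
  index that occurs (\<open>A\<close>, \<open>B\<close>, \<open>C\<close>, \<open>E\<close>). Once
  the common factor \<open>K\<close> is taken out, what remains is a polynomial identity in x = q^r,
  y = q^(n+1-r), z = q^(l-r) and q, with no division. For r > n + 1 all terms vanish.\<close>

lemma bailey_cert_telescopes:
  assumes q: "norm q < 1" and "r \<le> l"
  shows "(1 - q ^ (n + l + 2)) * (1 - q ^ (n + 1)) * (bailey_coeff q r * bailey_kernel q (Suc n) r * bailey_kernel q l r)
       - bailey_coeff q r * bailey_kernel q n r * bailey_kernel q l r
       = bailey_cert q l n r - bailey_cert q l n (Suc r)"
proof (cases "r \<le> Suc n")
  case True
  define x where "x = q ^ r"
  define y where "y = q ^ (Suc n - r)"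
  define z where "z = q ^ (l - r)"
  define e where "e = q ^ ((3 * r\<^sup>2 - r) div 2)"
  define s :: complex where "s = (- 1) ^ r"
  define A where "A = inverse_qpoch_diff q (Suc n) r"
  define B where "B = inverse_qpoch_diff q l r"
  define C where "C = 1 / qpoch q q (n + r + 2)"
  define E where "E = 1 / qpoch q q (l + r + 1)"
  have qn: "q ^ Suc n = y * x" "q ^ (n + 1) = y * x"
    using True by (simp_all add: x_def y_def flip: power_add power_Suc)
  have ql: "q ^ l = z * x"
    using assms(2) by (simp add: x_def z_def flip: power_add)
  have A': "inverse_qpoch_diff q n r = (1 - y) * A"
    unfolding A_def y_def by (rule inverse_qpoch_diff_Suc[OF q True])
  have B': "inverse_qpoch_diff q l (Suc r) = (1 - z) * B"
    unfolding B_def z_def by (rule inverse_qpoch_diff_Suc_right[OF q assms(2)])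
  have "q ^ Suc (n + r + 1) = q ^ Suc n * q ^ r * q" by (simp add: power_add)
  then have "q ^ Suc (n + r + 1) = y * x * x * q" by (simp only: qn(1) x_def[symmetric])
  then have C': "1 / qpoch q q (n + r + 1) = (1 - y * x * x * q) * C"
    using inverse_qpoch_q_pred[OF q, of "n + r + 1"] by (simp add: C_def)
  have "q ^ Suc (l + r) = q ^ l * q ^ r * q" by (simp add: power_add)
  then have "q ^ Suc (l + r) = z * x * x * q" by (simp only: ql x_def[symmetric])
  then have E': "1 / qpoch q q (l + r) = (1 - z * x * x * q) * E"
    using inverse_qpoch_q_pred[OF q, of "l + r"] by (simp add: E_def)
  have c: "bailey_coeff q r = s * (e * x) * (1 - x * x * q)"
    unfolding bailey_coeff_def bailey_coeff_exponent' s_def e_def x_def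
    by (simp add: power_add mult_2)
  have k1: "bailey_kernel q (Suc n) r = A * C"
    by (simp add: bailey_kernel_def A_def C_def)
  have k2: "bailey_kernel q n r = (1 - y) * A * ((1 - y * x * x * q) * C)"
    unfolding bailey_kernel_def A'[symmetric] C'[symmetric] by simp
  have k3: "bailey_kernel q l r = B * E"
    by (simp add: bailey_kernel_def B_def E_def)
  have g1: "bailey_cert q l n r = s * (y * x * e) * (1 - x) * A * ((1 - y * x * x * q) * C) * B * ((1 - z * x * x * q) * E)"
    unfolding bailey_cert_def C' E' power_add[of q "n + 1"] qn
    by (simp add: s_def e_def x_def A_def B_def)
  have g2: "bailey_cert q l n (Suc r) = - (s * (y * x * (e * x * (x * x * q))) * (1 - x * q) * ((1 - y) * A) * C * ((1 - z) * B) * E)"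
    unfolding bailey_cert_def power_add[of q "n + 1"] qn bailey_coeff_exponent bailey_coeff_exponent'[of r]
      B' inverse_qpoch_diff_Suc_Suc A'
    unfolding mult_2 power_add by (simp add: s_def e_def x_def C_def E_def mult_ac)
  have qnl: "q ^ (n + l + 2) = y * x * (z * x) * q"
    using qn ql by (simp add: power_add algebra_simps)
  define K where "K = s * e * x * A * B * C * E"
  have "(1 - y * x * (z * x) * q) * (1 - y * x) * (s * (e * x) * (1 - x * x * q) * (A * C) * (B * E))
      = K * ((1 - y * x * (z * x) * q) * (1 - y * x) * (1 - x * x * q))"
    by (simp only: K_def mult_ac)
  moreover have "s * (e * x) * (1 - x * x * q) * ((1 - y) * A * ((1 - y * x * x * q) * C)) * (B * E)
      = K * ((1 - x * x * q) * (1 - y) * (1 - y * x * x * q))"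
    by (simp only: K_def mult_ac)
  moreover have "s * (y * x * e) * (1 - x) * A * ((1 - y * x * x * q) * C) * B * ((1 - z * x * x * q) * E)
      = K * (y * (1 - x) * (1 - y * x * x * q) * (1 - z * x * x * q))"
    by (simp only: K_def mult_ac)
  moreover have "s * (y * x * (e * x * (x * x * q))) * (1 - x * q) * ((1 - y) * A) * C * ((1 - z) * B) * E
      = K * (y * x * x * x * q * (1 - x * q) * (1 - y) * (1 - z))"
    by (simp only: K_def mult_ac)
  moreover have "(1 - y * x * (z * x) * q) * (1 - y * x) * (1 - x * x * q)
        - (1 - x * x * q) * (1 - y) * (1 - y * x * x * q)
      = y * (1 - x) * (1 - y * x * x * q) * (1 - z * x * x * q)
        + y * x * x * x * q * (1 - x * q) * (1 - y) * (1 - z)"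
    by (simp add: algebra_simps)
  ultimately show ?thesis
    unfolding c k1 k2 k3 g1 g2 qnl qn
    by (simp only: minus_minus diff_minus_eq_add flip: right_diff_distrib distrib_left)
next
  case False
  then show ?thesis
    by (simp add: bailey_kernel_eq_0 bailey_cert_def inverse_qpoch_diff_def)
qed

text \<open>Both sides satisfy (1 - q^(n+l+2)) (1 - q^(n+1)) S(n+1) = S(n). For the sum this follows
  by telescoping: the certificate vanishes at r = 0 through 1 - q^r and at r = l + 1 through
  1/(q;q)_(l-r). At n = 0 only r = 0 survives.\<close>

lemma bailey_unit_pair:
  assumes q: "norm q < 1"
  shows "(\<Sum>r\<le>l. bailey_coeff q r * bailey_kernel q n r * bailey_kernel q l r)
           = 1 / (qpoch q q (n + l + 1) * qpoch q q n * qpoch q q l)"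
proof (induction n)
  case 0
  have "(\<Sum>r\<le>l. bailey_coeff q r * bailey_kernel q 0 r * bailey_kernel q l r)
      = (\<Sum>r\<in>{0}. bailey_coeff q r * bailey_kernel q 0 r * bailey_kernel q l r)"
    by (intro sum.mono_neutral_right) (auto simp: bailey_kernel_eq_0)
  then show ?case
    using one_minus_power_nonzero[OF q, of 1]
    by (simp add: bailey_coeff_def bailey_kernel_def inverse_qpoch_diff_def qpoch_Suc)
next
  case (Suc n)
  note nz = qpoch_q_nonzero[OF q] one_minus_power_nonzero[OF q]
  define S where "S n = (\<Sum>r\<le>l. bailey_coeff q r * bailey_kernel q n r * bailey_kernel q l r)" for n
  have "(1 - q ^ (n + l + 2)) * (1 - q ^ (n + 1)) * S (Suc n) - S n
      = (\<Sum>r\<le>l. bailey_cert q l n r - bailey_cert q l n (Suc r))"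
    unfolding S_def sum_distrib_left sum_subtractf[symmetric]
    by (intro sum.cong refl bailey_cert_telescopes q) simp
  also have "\<dots> = 0"
    by (subst sum_telescope) (simp add: bailey_cert_def inverse_qpoch_diff_def)
  finally have "(1 - q ^ Suc (n + l + 1)) * (1 - q ^ Suc n) * S (Suc n) = 1 / (qpoch q q (n + l + 1) * qpoch q q n * qpoch q q l)"
    using Suc by (simp add: S_def)
  \<comment> \<open>If X * Y * Z = 0, then 1 / 0 = 0 forces s = 0, and the right side is 0 as
    well.\<close>
  moreover have "s = 1 / (X * a * (Y * b) * Z)"
    if "a * b * s = 1 / (X * Y * Z)" "a \<noteq> 0" "b \<noteq> 0" for a b s X Y Z :: complex
    using that by (cases "X * Y * Z = 0") (auto simp: field_simps)
  moreover have "qpoch q q (Suc n + l + 1) = qpoch q q (n + l + 1) * (1 - q ^ Suc (n + l + 1))"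
    using qpoch_q_Suc[of q "n + l + 1"] by simp
  ultimately show ?case
    using nz(2)[of "Suc (n + l + 1)"] nz(2)[of "Suc n"]
    unfolding S_def[symmetric] qpoch_q_Suc[of q n] by simp
qed

text \<open>With n = m + r the exponent splits as n^2 + n = (r^2 + r) + m (m + 2r + 1), which
  exposes a q-Vandermonde term with c = 2r + 1 and the eigenvalue as a constant factor.\<close>

lemma bailey_kernel_shift:
  "q ^ ((m + r)\<^sup>2 + (m + r)) * bailey_kernel q (m + r) r
     = q ^ (r\<^sup>2 + r) * (q ^ (m * (m + (2 * r + 1))) / (qpoch q q m * qpoch q q (m + (2 * r + 1))))"
proof -
  have "(m + r)\<^sup>2 + (m + r) = (r\<^sup>2 + r) + m * (m + (2 * r + 1))"
    by (simp add: power2_eq_square algebra_simps)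
  then have "q ^ ((m + r)\<^sup>2 + (m + r)) = q ^ (r\<^sup>2 + r) * q ^ (m * (m + (2 * r + 1)))"
    by (simp only: power_add)
  moreover have s: "m + r + r + 1 = m + (2 * r + 1)" by simp
  ultimately show ?thesis
    unfolding bailey_kernel_def inverse_qpoch_diff_def s by simp
qed

text \<open>The Bailey lemma with both of its free parameters sent to infinity, in eigenvector form:
  q-Vandermonde with M = N - r and c = 2r + 1.\<close>

lemma bailey_kernel_step:
  assumes q: "norm q < 1"
  shows "(\<Sum>n\<le>N. q ^ (n\<^sup>2 + n) / qpoch q q (N - n) * bailey_kernel q n r)
           = q ^ (r\<^sup>2 + r) * bailey_kernel q N r"
proof (cases "r \<le> N")
  case True
  have "(\<Sum>n\<le>N. q ^ (n\<^sup>2 + n) / qpoch q q (N - n) * bailey_kernel q n r)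
      = (\<Sum>n\<in>{r..N}. q ^ (n\<^sup>2 + n) / qpoch q q (N - n) * bailey_kernel q n r)"
    by (intro sum.mono_neutral_right) (auto simp: bailey_kernel_eq_0)
  also have "\<dots> = (\<Sum>m\<le>N - r. q ^ (r\<^sup>2 + r) * (q ^ (m * (m + (2 * r + 1))) / (qpoch q q m * qpoch q q (N - r - m) * qpoch q q (m + (2 * r + 1)))))"
  proof (rule sum.reindex_bij_witness[of _ "\<lambda>m. m + r" "\<lambda>n. n - r"])
    fix n assume n: "n \<in> {r..N}"
    then obtain m where m: "n = m + r" by (metis atLeastAtMost_iff le_add_diff_inverse2)
    have "q ^ (n\<^sup>2 + n) / qpoch q q (N - n) * bailey_kernel q n r
        = q ^ (n\<^sup>2 + n) * bailey_kernel q n r / qpoch q q (N - n)" by simp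
    then show "q ^ (r\<^sup>2 + r) * (q ^ ((n - r) * ((n - r) + (2 * r + 1))) / (qpoch q q (n - r) * qpoch q q (N - r - (n - r)) * qpoch q q ((n - r) + (2 * r + 1)))) = q ^ (n\<^sup>2 + n) / qpoch q q (N - n) * bailey_kernel q n r"
      unfolding m bailey_kernel_shift by (simp add: add.commute)
  qed (use True in auto)
  also have "\<dots> = q ^ (r\<^sup>2 + r) * bailey_kernel q N r"
    unfolding sum_distrib_left[symmetric] q_vandermonde[OF q]
    using True by (simp add: bailey_kernel_def inverse_qpoch_diff_def add.commute)
  finally show ?thesis .
qed (auto intro!: sum.neutral simp: bailey_kernel_eq_0)

text \<open>The analogue for the largest index of a chain, whose range is unbounded;
  \<open>q_vandermonde_inf\<close> replaces the finite sum.\<close>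

lemma bailey_kernel_has_sum:
  assumes q: "norm q < 1"
  shows "((\<lambda>n. q ^ (n\<^sup>2 + n) * bailey_kernel q n r) has_sum (q ^ (r\<^sup>2 + r) / qpoch_inf q q)) UNIV"
proof -
  define b where "b m = q ^ (m * (m + (2 * r + 1))) / (qpoch q q m * qpoch q q (m + (2 * r + 1)))" for m
  have "summable (\<lambda>m. norm (b m))" "suminf b = 1 / qpoch_inf q q"
    using q_vandermonde_inf[OF q, of "2 * r + 1"] by (simp_all add: b_def[abs_def])
  then have "(b has_sum (1 / qpoch_inf q q)) UNIV"
    by (metis norm_summable_imp_has_sum summable_norm_cancel summable_sums)
  then have "((\<lambda>m. q ^ (r\<^sup>2 + r) * b m) has_sum (q ^ (r\<^sup>2 + r) * (1 / qpoch_inf q q))) UNIV"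
    by (rule has_sum_cmult_right)
  then have "((\<lambda>n. q ^ (n\<^sup>2 + n) * bailey_kernel q n r) has_sum (q ^ (r\<^sup>2 + r) * (1 / qpoch_inf q q))) {r..}"
  proof (rule has_sum_reindex_bij_witness[THEN iffD2, rotated -1])
    fix n assume n: "n \<in> {r..}"
    then obtain m where m: "n = m + r" by (metis atLeast_iff le_add_diff_inverse2)
    show "q ^ (r\<^sup>2 + r) * b (n - r) = q ^ (n\<^sup>2 + n) * bailey_kernel q n r"
      unfolding m bailey_kernel_shift by (simp add: b_def)
  next
    show "m + r - r = m" for m by simp
  qed auto
  then show ?thesis
    using has_sum_cong_neutral[of UNIV "{r..}"
        "\<lambda>n. q ^ (n\<^sup>2 + n) * bailey_kernel q n r" "\<lambda>n. q ^ (n\<^sup>2 + n) * bailey_kernel q n r"]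
    by (simp add: bailey_kernel_eq_0)
qed

subsection \<open>The Jacobi triple product\<close>

lemma bailey_kernel_pred:
  assumes "norm q < 1" "r \<le> Suc n"
  shows "bailey_kernel q n r = (1 - q ^ (Suc n - r)) * (1 - q ^ (n + r + 2)) * bailey_kernel q (Suc n) r"
proof -
  have "1 / qpoch q q (n + r + 1) = (1 - q ^ (n + r + 2)) * (1 / qpoch q q (Suc n + r + 1))"
    using inverse_qpoch_q_pred[OF assms(1), of "n + r + 1"] by simp
  then show ?thesis
    using inverse_qpoch_diff_Suc[OF assms] by (simp add: bailey_kernel_def divide_inverse del: power_Suc)
qed

text \<open>The factor q on the left keeps the right side polynomial in q and q^(n+1-r): for r <= n,
  q - q^(n+1-r) is q (1 - q^(n-r)), and at r = n + 1 both sides vanish.\<close>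

lemma bailey_kernel_pred_Suc:
  assumes "norm q < 1" "r \<le> Suc n"
  shows "q * bailey_kernel q n (Suc r)
           = (1 - q ^ (Suc n - r)) * (q - q ^ (Suc n - r)) * bailey_kernel q (Suc n) r"
proof (cases "r = Suc n")
  case False
  with assms have r: "r \<le> n" by simp
  have "inverse_qpoch_diff q n (Suc r) = (1 - q ^ (n - r)) * ((1 - q ^ (Suc n - r)) * inverse_qpoch_diff q (Suc n) r)"
    using inverse_qpoch_diff_Suc[OF assms] inverse_qpoch_diff_Suc_right[OF assms(1) r] by simp
  moreover have "q - q ^ (Suc n - r) = q * (1 - q ^ (n - r))"
    using r by (simp add: Suc_diff_le right_diff_distrib)
  ultimately show ?thesis by (simp add: bailey_kernel_def)
qed (simp add: bailey_kernel_eq_0)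

lemma bailey_kernel_pred_pred:
  assumes "norm q < 1"
  shows "bailey_kernel q n r = (1 - q ^ (n + r + 2)) * (1 - q ^ (n + r + 3)) * bailey_kernel q (Suc n) (Suc r)"
proof -
  have N: "Suc (n + r + 1) = n + r + 2" "Suc (n + r + 2) = n + r + 3" "Suc n + Suc r + 1 = n + r + 3"
    by simp_all
  have "1 / qpoch q q (n + r + 1) = (1 - q ^ (n + r + 2)) * ((1 - q ^ (n + r + 3)) * (1 / qpoch q q (n + r + 3)))"
    using inverse_qpoch_q_pred[OF assms, of "n + r + 1"] inverse_qpoch_q_pred[OF assms, of "n + r + 2"]
    unfolding N by (rule trans[OF _ arg_cong])
  then have "inverse_qpoch_diff q n r * (1 / qpoch q q (n + r + 1))
      = inverse_qpoch_diff q n r * ((1 - q ^ (n + r + 2)) * ((1 - q ^ (n + r + 3)) * (1 / qpoch q q (n + r + 3))))"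
    by (rule arg_cong)
  then show ?thesis
    unfolding bailey_kernel_def inverse_qpoch_diff_Suc_Suc N by (simp only: divide_inverse mult_1 mult_ac)
qed

text \<open>The bilateral theta series is folded by pairing its terms of index \<open>r\<close> and \<open>-1 - r\<close>.\<close>

definition theta_sign :: "complex \<Rightarrow> nat \<Rightarrow> complex" where
  "theta_sign q r = (- 1) ^ r * q ^ (r * (r + 1) div 2)"

definition theta_diff :: "complex \<Rightarrow> nat \<Rightarrow> complex" where
  "theta_diff z r = inverse z ^ r - z ^ (r + 1)"

lemma theta_sign_Suc: "theta_sign q (Suc r) = - (q ^ Suc r * theta_sign q r)"
proof -
  have "Suc r * (Suc r + 1) = r * (r + 1) + Suc r * 2" by simp
  then have "Suc r * (Suc r + 1) div 2 = (r * (r + 1) + Suc r * 2) div 2" by (rule arg_cong)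
  also have "\<dots> = Suc r + r * (r + 1) div 2" by (subst div_mult_self1) auto
  finally show ?thesis unfolding theta_sign_def power_add[of q "Suc r"] by (simp only:) (simp add: power_add)
qed

text \<open>z and 1/z are the roots of t^2 - (z + 1/z) t + 1. The second equation is the same
  recurrence one index lower, with the folding antisymmetry d(-1) = -d(0).\<close>

lemma theta_diff_recurrence:
  assumes "z \<noteq> 0"
  shows "theta_diff z (Suc (Suc r)) + theta_diff z r = (z + inverse z) * theta_diff z (Suc r)"
    and "theta_diff z (Suc 0) - theta_diff z 0 = (z + inverse z) * theta_diff z 0"
proof -
  have i: "z * inverse z = 1" using assms by simp
  have "i * (i * p) - z * (z * (z * w)) + (p - z * w) = (z + i) * (i * p - z * (z * w))"
    "i - z * z - (1 - z) = (z + i) * (1 - z)" if "z * i = 1" for i p w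
    using that by algebra+
  from this[OF i] show "theta_diff z (Suc (Suc r)) + theta_diff z r = (z + inverse z) * theta_diff z (Suc r)"
    and "theta_diff z (Suc 0) - theta_diff z 0 = (z + inverse z) * theta_diff z 0"
    by (simp_all add: theta_diff_def)
qed

text \<open>This is multiplication by (1 - zA) (1 - A/z), with A = q^(n+1), read off on the
  coefficients of a Laurent polynomial in z. The value - u 0 stands for u(-1): in the bilateral
  series the coefficients of index r and -1 - r are opposite.\<close>

lemma theta_kernel_recurrence:
  assumes q: "norm q < 1" and r: "r \<le> Suc n"
  defines "u \<equiv> \<lambda>r. theta_sign q r * bailey_kernel q n r"
  shows "(1 - q ^ (2 * n + 2)) * (1 - q ^ (2 * n + 3)) * (theta_sign q r * bailey_kernel q (Suc n) r)
           = (1 + q ^ (2 * n + 2)) * u r - q ^ (n + 1) * ((case r of 0 \<Rightarrow> - u 0 | Suc s \<Rightarrow> u s) + u (Suc r))"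
proof -
  define x where "x = q ^ r"
  define y where "y = q ^ (Suc n - r)"
  define e where "e = theta_sign q r"
  define w where "w = bailey_kernel q (Suc n) r"
  have A: "q ^ (n + 1) = y * x"
    using r by (simp add: x_def y_def flip: power_add power_Suc)
  have A2: "q ^ (2 * n + 2) = y * x * (y * x)" "q ^ (2 * n + 3) = y * x * (y * x) * q"
  proof -
    have "q ^ (2 * n + 2) = q ^ (n + 1) * q ^ (n + 1)" by (simp add: mult_2 power_add)
    then show "q ^ (2 * n + 2) = y * x * (y * x)" by (simp only: A)
    then show "q ^ (2 * n + 3) = y * x * (y * x) * q" by (simp add: numeral_3_eq_3)
  qed
  have "q ^ (n + r + 2) = q ^ (n + 1) * q ^ r * q" by (simp add: power_add)
  then have B: "q ^ (n + r + 2) = y * x * x * q" by (simp only: A x_def[symmetric])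
  have u_r: "u r = e * ((1 - y) * (1 - y * x * x * q) * w)"
    unfolding u_def bailey_kernel_pred[OF q r] B by (simp add: e_def y_def w_def)
  have "u (Suc r) = - (x * e * (q * bailey_kernel q n (Suc r)))"
    by (simp add: u_def theta_sign_Suc x_def e_def)
  then have u_Suc: "u (Suc r) = - (x * e * ((1 - y) * (q - y) * w))"
    unfolding bailey_kernel_pred_Suc[OF q r] by (simp add: y_def w_def)
  have u_pred: "q ^ (n + 1) * (case r of 0 \<Rightarrow> - u 0 | Suc s \<Rightarrow> u s) = - (y * e * ((1 - y * x * x) * (1 - y * x * x * q) * w))"
  proof (cases r)
    case 0
    then show ?thesis using u_r A by (simp add: x_def)
  next
    case (Suc s)
    have "q ^ (n + r + 1) = q ^ (n + 1) * q ^ r" by (simp add: power_add)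
    then have B': "q ^ (n + r + 1) = y * x * x" by (simp only: A x_def[symmetric])
    have "bailey_kernel q n s = (1 - y * x * x) * (1 - y * x * x * q) * w"
      using bailey_kernel_pred_pred[OF q, of n s] B B' Suc by (simp add: w_def numeral_3_eq_3)
    moreover have "e = - (x * theta_sign q s)"
      by (simp add: e_def x_def Suc theta_sign_Suc)
    ultimately show ?thesis
      unfolding A by (simp add: Suc u_def)
  qed
  have "(1 - y * x * (y * x)) * (1 - y * x * (y * x) * q)
      = (1 + y * x * (y * x)) * ((1 - y) * (1 - y * x * x * q))
        + y * ((1 - y * x * x) * (1 - y * x * x * q)) + y * x * (x * ((1 - y) * (q - y)))"
    by (simp add: algebra_simps)
  moreover have "X * (e * w) = p * (e * (a * w)) - (- (y * e * (b * w)) + y * x * (- (x * e * (c * w))))"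
    if "X = p * a + y * b + y * x * (x * c)" for X p a b c
    unfolding that by (simp add: algebra_simps)
  ultimately show ?thesis
    unfolding distrib_left[of "q ^ (n + 1)"] u_pred u_r u_Suc A2 e_def[symmetric] w_def[symmetric]
    unfolding A by blast
qed

text \<open>Up to a monomial, (z;q)_(n+1) (q/z;q)_n is the product of 1 - z q^j over -n <= j <= n,
  so this is a folded q-binomial theorem. Each induction step adjoins one factor at either
  end.\<close>

lemma finite_triple_product:
  assumes q: "norm q < 1" and z: "z \<noteq> 0"
  shows "(\<Sum>r\<le>n. theta_sign q r * theta_diff z r * bailey_kernel q n r)
           = qpoch z q (n + 1) * qpoch (q / z) q n / qpoch q q (2 * n + 1)"
proof (induction n)
  case 0
  then show ?case
    by (simp add: theta_sign_def theta_diff_def bailey_kernel_def inverse_qpoch_diff_def qpoch_Suc)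
next
  case (Suc n)
  define A where "A = q ^ (n + 1)"
  define u where "u r = theta_sign q r * bailey_kernel q n r" for r
  define d where "d = theta_diff z"
  \<comment> \<open>Summation by parts: T r is the discrete Wronskian A (u(r-1) d(r) - u(r) d(r-1)).
    At r = 0 it is 0 since u(-1) = -u(0) and d(-1) = -d(0).\<close>
  define T where "T r = (case r of 0 \<Rightarrow> 0 | Suc s \<Rightarrow> A * (u s * d (Suc s) - u (Suc s) * d s))" for r
  define S where "S n = (\<Sum>r\<le>n. theta_sign q r * theta_diff z r * bailey_kernel q n r)" for n
  define L where "L = (1 - q ^ (2 * n + 2)) * (1 - q ^ (2 * n + 3))"
  have A2: "q ^ (2 * n + 2) = A * A"
    by (simp add: A_def mult_2 power_add)
  \<comment> \<open>The extra term r = n + 1 is 0; it gives both sums the same range.\<close>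
  have S_n: "S n = (\<Sum>r\<le>Suc n. u r * d r)"
    by (simp add: S_def u_def d_def bailey_kernel_eq_0 mult_ac)
  have "L * S (Suc n) - (1 - z * A) * (1 - inverse z * A) * S n
      = (\<Sum>r\<le>Suc n. L * (theta_sign q r * bailey_kernel q (Suc n) r) * d r - (1 - z * A) * (1 - inverse z * A) * (u r * d r))"
    unfolding S_n sum_subtractf unfolding S_def sum_distrib_left by (simp add: d_def mult_ac)
  also have "\<dots> = (\<Sum>r\<le>Suc n. T (Suc r) - T r)"
  proof (intro sum.cong refl)
    fix r assume "r \<in> {..Suc n}"
    then have K: "L * (theta_sign q r * bailey_kernel q (Suc n) r)
        = (1 + A * A) * u r - A * ((case r of 0 \<Rightarrow> - u 0 | Suc s \<Rightarrow> u s) + u (Suc r))"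
      using theta_kernel_recurrence[OF q, of r n] unfolding L_def u_def A2 A_def by simp
    have Z: "(1 - z * A) * (1 - inverse z * A) = 1 + A * A - A * (z + inverse z)"
      using z by (simp add: field_simps)
    show "L * (theta_sign q r * bailey_kernel q (Suc n) r) * d r - (1 - z * A) * (1 - inverse z * A) * (u r * d r) = T (Suc r) - T r"
    proof (cases r)
      case 0
      have "(z + inverse z) * d 0 = d (Suc 0) - d 0"
        using theta_diff_recurrence(2)[OF z] by (simp add: d_def)
      then show ?thesis unfolding K Z unfolding 0 T_def by simp algebra
    next
      case (Suc s)
      have "(z + inverse z) * d (Suc s) = d (Suc (Suc s)) + d s"
        using theta_diff_recurrence(1)[OF z] by (simp add: d_def)
      then show ?thesis unfolding K Z unfolding Suc T_def by simp algebra
    qed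
  qed
  also have "\<dots> = T (Suc (Suc n)) - T 0"
    unfolding lessThan_Suc_atMost[symmetric] by (rule sum_lessThan_telescope)
  also have "\<dots> = 0"
    by (simp add: T_def u_def bailey_kernel_eq_0)
  finally have "L * S (Suc n) = (1 - z * A) * (1 - inverse z * A) * S n" by simp
  also have "S n = qpoch z q (n + 1) * qpoch (q / z) q n / qpoch q q (2 * n + 1)"
    using Suc by (simp add: S_def)
  finally have "L * S (Suc n) = (1 - z * A) * (1 - inverse z * A) * (qpoch z q (n + 1) * qpoch (q / z) q n / qpoch q q (2 * n + 1))" .
  moreover have "s = X * a * (Y * b) / (Z * L)"
    if "L * s = a * b * (X * Y / Z)" "L \<noteq> 0" for L s a b X Y Z :: complex
    using that by (cases "Z = 0") (auto simp: field_simps)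
  moreover have "qpoch z q (Suc n + 1) = qpoch z q (n + 1) * (1 - z * A)"
    by (simp add: A_def qpoch_Suc)
  moreover have "qpoch (q / z) q (Suc n) = qpoch (q / z) q n * (1 - inverse z * A)"
    by (simp add: A_def qpoch_Suc divide_inverse mult_ac)
  moreover have "qpoch q q (2 * Suc n + 1) = qpoch q q (2 * n + 1) * L"
    by (simp add: L_def qpoch_q_Suc numeral_3_eq_3 del: power_Suc)
  moreover have "L \<noteq> 0"
    unfolding L_def by (intro no_zero_divisors one_minus_power_nonzero q) simp_all
  ultimately show ?case
    unfolding S_def[symmetric] by (simp only:)
qed

text \<open>As n grows the kernel tends to 1 / P^2 and stays below C^2, so Tannery's theorem applies
  to \<open>finite_triple_product\<close>. In the application the summability hypothesis comes from
  the decay of \<open>bailey_coeff\<close>.\<close>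

lemma triple_product:
  assumes q: "norm q < 1" and z: "z \<noteq> 0"
    and summable: "summable (\<lambda>r. norm (theta_sign q r * theta_diff z r))"
  shows "(\<Sum>r. theta_sign q r * theta_diff z r) = qpoch_inf z q * qpoch_inf (q / z) q * qpoch_inf q q"
proof -
  obtain C where C: "C > 0" "\<And>n. norm (1 / qpoch q q n) \<le> C"
    using inverse_qpoch_q_bounded[OF q] by blast
  define P where "P = qpoch_inf q q"
  have P: "P \<noteq> 0" unfolding P_def by (rule qpoch_inf_q_nonzero[OF q])
  have D: "qpoch q q \<longlonglongrightarrow> P" unfolding P_def by (rule qpoch_tendsto[OF q])
  define c where "c r = theta_sign q r * theta_diff z r" for r
  have "(\<lambda>n. \<Sum>r. c r * bailey_kernel q n r) \<longlonglongrightarrow> (\<Sum>r. c r * (1 / (P * P)))"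
  proof (rule tannerys_theorem[THEN conjunct2, THEN conjunct2])
    show "(\<lambda>n. c r * bailey_kernel q n r) \<longlonglongrightarrow> c r * (1 / (P * P))" for r
    proof -
      have "(\<lambda>n. c r * (1 / (qpoch q q n * qpoch q q (n + (2 * r + 1))))) \<longlonglongrightarrow> c r * (1 / (P * P))"
        using P by (intro tendsto_intros D LIMSEQ_ignore_initial_segment) auto
      then have "(\<lambda>n. c r * bailey_kernel q (n + r) r) \<longlonglongrightarrow> c r * (1 / (P * P))"
        by (simp add: bailey_kernel_def inverse_qpoch_diff_def mult_2 add.assoc)
      then show ?thesis by (rule LIMSEQ_offset)
    qed
    show "\<forall>\<^sub>F (r, n) in sequentially \<times>\<^sub>F sequentially. norm (c r * bailey_kernel q n r) \<le> norm (c r) * (C * C)"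
    proof (intro always_eventually allI, clarify)
      fix r n
      have "norm (1 / qpoch q q (n - r)) * norm (1 / qpoch q q (n + r + 1)) \<le> C * C"
        using C by (intro mult_mono) (auto intro: less_imp_le)
      then have "norm (bailey_kernel q n r) \<le> C * C"
        using C(1) by (auto simp: bailey_kernel_def inverse_qpoch_diff_def norm_divide norm_mult)
      then show "norm (c r * bailey_kernel q n r) \<le> norm (c r) * (C * C)"
        by (simp add: norm_mult mult_left_mono)
    qed
    show "summable (\<lambda>r. norm (c r) * (C * C))"
      unfolding c_def by (intro summable_mult2 summable)
  qed simp
  moreover have "(\<Sum>r. c r * bailey_kernel q n r) = qpoch z q (n + 1) * qpoch (q / z) q n / qpoch q q (2 * n + 1)" for n
    unfolding finite_triple_product[OF q z, symmetric] c_def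
    by (intro suminf_finite) (auto simp: bailey_kernel_eq_0)
  moreover have "(\<lambda>n. qpoch z q (n + 1) * qpoch (q / z) q n / qpoch q q (2 * n + 1))
      \<longlonglongrightarrow> qpoch_inf z q * qpoch_inf (q / z) q / P"
  proof -
    have "(\<lambda>n. qpoch q q (2 * n + 1)) \<longlonglongrightarrow> P"
      by (rule filterlim_compose[OF D]) (intro filterlim_subseq strict_monoI, simp)
    then show ?thesis
      by (intro tendsto_intros LIMSEQ_ignore_initial_segment qpoch_tendsto q P)
  qed
  ultimately have "(\<Sum>r. c r * (1 / (P * P))) = qpoch_inf z q * qpoch_inf (q / z) q / P"
    by (auto intro: LIMSEQ_unique)
  moreover have "(\<Sum>r. c r * (1 / (P * P))) = (\<Sum>r. c r) * (1 / (P * P))"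
    using summable unfolding c_def by (rule suminf_mult2[symmetric, OF summable_norm_cancel])
  ultimately show ?thesis
    unfolding P_def[symmetric] c_def[symmetric] using P by (simp add: field_simps)
qed

subsection \<open>The product side\<close>

text \<open>Blocks start at exponent 1, so the excluded residues 1, -1, 0 modulo M sit at offsets i
  = 0, M - 2, M - 1.\<close>

lemma product_factor_block:
  assumes M: "M = 4 * k + 3" and i: "i < M"
  shows "product_factor k q (Suc (m * M + i))
           = (if i \<in> {0, M - 2, M - 1} then 1 else 1 / (1 - q ^ Suc (m * M + i)))"
proof -
  \<comment> \<open>The bound 2 * M covers j = i, i + 1 and i + 2, since i < M and M >= 3.\<close>
  have multiple: "int M dvd int (m * M) + int j \<longleftrightarrow> j = 0 \<or> j = M" if "j < 2 * M" for j
  proof -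
    have "int M dvd int (m * M) + int j \<longleftrightarrow> M dvd j"
      by (subst dvd_add_right_iff) simp_all
    also have "\<dots> \<longleftrightarrow> j = 0 \<or> j = M"
    proof
      assume "M dvd j"
      then obtain t where t: "j = t * M" by (metis dvdE mult.commute)
      then have "t < 2" using that by simp
      then show "j = 0 \<or> j = M" using t by (auto simp: less_2_cases_iff)
    qed auto
    finally show ?thesis .
  qed
  have "[int (Suc (m * M + i)) = 0] (mod 4 * int k + 3) \<longleftrightarrow> int M dvd int (m * M) + int (i + 1)"
    by (simp add: cong_iff_dvd_diff M algebra_simps)
  moreover have "[int (Suc (m * M + i)) = 1] (mod 4 * int k + 3) \<longleftrightarrow> int M dvd int (m * M) + int i"
    by (simp add: cong_iff_dvd_diff M algebra_simps)
  moreover have "[int (Suc (m * M + i)) = - 1] (mod 4 * int k + 3) \<longleftrightarrow> int M dvd int (m * M) + int (i + 2)"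
    by (simp add: cong_iff_dvd_diff M algebra_simps)
  ultimately show ?thesis
    using multiple[of i] multiple[of "i + 1"] multiple[of "i + 2"] M i
    unfolding product_factor_def by auto
qed

lemma prod_product_factor:
  fixes q :: complex
  assumes M: "M = 4 * k + 3" and q: "norm q < 1"
  shows "(\<Prod>m<n * M. product_factor k q (Suc m)) * qpoch q q (n * M)
           = qpoch q (q ^ M) n * qpoch (q ^ (M - 1)) (q ^ M) n * qpoch (q ^ M) (q ^ M) n"
proof -
  define g where "g m = product_factor k q (Suc m) * (1 - q ^ Suc m)" for m
  have block: "prod g {m * M..<m * M + M} = (1 - q * (q ^ M) ^ m) * (1 - q ^ (M - 1) * (q ^ M) ^ m) * (1 - q ^ M * (q ^ M) ^ m)" for m
  proof -
    have "prod g {m * M..<m * M + M} = (\<Prod>i<M. g (m * M + i))"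
      by (rule prod.reindex_bij_witness[of _ "\<lambda>i. m * M + i" "\<lambda>i. i - m * M"]) auto
    also have "\<dots> = (\<Prod>i\<in>{0, M - 2, M - 1}. g (m * M + i))"
    proof (intro prod.mono_neutral_right ballI)
      fix i assume "i \<in> {..<M} - {0, M - 2, M - 1}"
      then show "g (m * M + i) = 1"
        using one_minus_power_nonzero[OF q, of "Suc (m * M + i)"]
        by (auto simp: g_def product_factor_block[OF M] simp del: power_Suc)
    qed (use M in auto)
    also have "\<dots> = (\<Prod>i\<in>{0, M - 2, M - 1}. 1 - q ^ Suc (m * M + i))"
    proof (intro prod.cong refl)
      fix i assume i: "i \<in> {0, M - 2, M - 1}"
      then have "i < M" using M by auto
      then show "g (m * M + i) = 1 - q ^ Suc (m * M + i)"
        unfolding g_def product_factor_block[OF M \<open>i < M\<close>] using i by simp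
    qed
    also have "\<dots> = (1 - q ^ Suc (m * M + 0)) * ((1 - q ^ Suc (m * M + (M - 2))) * (1 - q ^ Suc (m * M + (M - 1))))"
    proof -
      have "0 \<noteq> M - 2" "0 \<noteq> M - 1" "M - 2 \<noteq> M - 1" using M by auto
      then show ?thesis by (simp only: prod.insert prod.empty finite.intros insert_iff empty_iff mult_1_right simp_thms)
    qed
    also have "Suc (m * M + 0) = 1 + M * m" by simp
    also have "Suc (m * M + (M - 2)) = M - 1 + M * m" using M by simp
    also have "Suc (m * M + (M - 1)) = M + M * m" using M by simp
    finally show ?thesis
      by (simp only: power_add power_mult power_one_right mult.assoc)
  qed
  have "(\<Prod>m<n * M. product_factor k q (Suc m)) * qpoch q q (n * M) = prod g {..<n * M}"
    by (simp add: g_def qpoch_def prod.distrib)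
  also have "\<dots> = (\<Prod>m<n. prod g {m * M..<m * M + M})"
    by (rule prod.nat_group[symmetric])
  finally show ?thesis
    unfolding block by (simp add: qpoch_def prod.distrib)
qed

lemma prodinf_product_factor:
  fixes q :: complex
  assumes M: "M = 4 * k + 3" and q: "norm q < 1"
  shows "(\<Prod>m. product_factor k q m) * qpoch_inf q q
           = qpoch_inf q (q ^ M) * qpoch_inf (q ^ (M - 1)) (q ^ M) * qpoch_inf (q ^ M) (q ^ M)"
proof -
  have mono: "strict_mono (\<lambda>n. n * M)" using M by (simp add: strict_mono_def)
  have qM: "norm (q ^ M) < 1"
    using q M by (simp add: norm_power power_less_one_iff)
  have "(\<lambda>n. \<Prod>m\<le>n. product_factor k q m) \<longlonglongrightarrow> (\<Prod>m. product_factor k q m)"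
    by (intro convergent_prod_LIMSEQ convergent_prod_product_factor q)
  moreover have "(\<Prod>m\<le>n. product_factor k q m) = (\<Prod>m<n. product_factor k q (Suc m))" for n
    unfolding lessThan_Suc_atMost[symmetric] prod.lessThan_Suc_shift by (simp add: product_factor_def)
  ultimately have "(\<lambda>n. \<Prod>m<n. product_factor k q (Suc m)) \<longlonglongrightarrow> (\<Prod>m. product_factor k q m)"
    by simp
  then have "(\<lambda>n. (\<Prod>m<n * M. product_factor k q (Suc m)) * qpoch q q (n * M))
      \<longlonglongrightarrow> (\<Prod>m. product_factor k q m) * qpoch_inf q q"
    using LIMSEQ_subseq_LIMSEQ[OF _ mono] qpoch_tendsto[OF q, of q]
    by (intro tendsto_mult) (auto simp: o_def)
  moreover have "(\<lambda>n. qpoch q (q ^ M) n * qpoch (q ^ (M - 1)) (q ^ M) n * qpoch (q ^ M) (q ^ M) n)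
      \<longlonglongrightarrow> qpoch_inf q (q ^ M) * qpoch_inf (q ^ (M - 1)) (q ^ M) * qpoch_inf (q ^ M) (q ^ M)"
    by (intro tendsto_mult qpoch_tendsto qM)
  ultimately show ?thesis
    unfolding prod_product_factor[OF M q] by (rule LIMSEQ_unique)
qed

section \<open>The theta series of modulus 4k + 3\<close>

lemma norm_bailey_coeff_le:
  assumes "norm q < 1"
  shows "norm (bailey_coeff q r) \<le> 2 * norm q ^ r"
proof -
  have "norm (1 - q ^ (2 * r + 1)) \<le> 1 + norm q ^ (2 * r + 1)"
    using norm_triangle_ineq4[of 1 "q ^ (2 * r + 1)"] by (simp add: norm_mult norm_power)
  also have "\<dots> \<le> 2"
    using assms power_le_one[of "norm q" "2 * r + 1"] by simp
  finally have "norm (1 - q ^ (2 * r + 1)) \<le> 2" .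
  moreover have "norm q ^ ((3 * r\<^sup>2 + r) div 2) \<le> norm q ^ r"
    using assms unfolding bailey_coeff_exponent' by (intro power_decreasing) auto
  ultimately show ?thesis
    unfolding bailey_coeff_def by (simp add: norm_mult norm_power mult_mono mult.commute)
qed

lemma summable_norm_bailey_coeff:
  assumes "norm q < 1"
  shows "summable (\<lambda>r. norm (bailey_coeff q r))"
proof (rule summable_comparison_test)
  show "\<exists>N. \<forall>r\<ge>N. norm (norm (bailey_coeff q r)) \<le> 2 * norm q ^ r"
    using norm_bailey_coeff_le[OF assms] by simp
  show "summable (\<lambda>r. 2 * norm q ^ r)"
    using assms by (intro summable_mult summable_geometric) simp
qed

text \<open>Put t = r(r+1)/2. The square collects the eigenvalues of the n-chain and the l-chain,
  4kt in the exponent. The q^(-r) in \<open>theta_diff q r\<close> accounts for the difference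
  between 3t and (3r^2 + r)/2.\<close>

lemma theta_eq_bailey_coeff:
  assumes "q \<noteq> 0"
  shows "theta_sign (q ^ (4 * k + 3)) r * theta_diff q r = bailey_coeff q r * (q ^ (k * (r\<^sup>2 + r)))\<^sup>2"
proof -
  define t where "t = r * (r + 1) div 2"
  have t: "r\<^sup>2 + r = 2 * t" by (simp add: t_def power2_eq_square)
  have e: "(3 * r\<^sup>2 + r) div 2 + r = 3 * t"
  proof -
    have "(3 * r\<^sup>2 + r) + r * 2 = 3 * (r\<^sup>2 + r)" by simp
    then have "(3 * r\<^sup>2 + r) + r * 2 = 3 * t * 2" unfolding t by simp
    then have "((3 * r\<^sup>2 + r) + r * 2) div 2 = 3 * t" by (simp only: nonzero_mult_div_cancel_right zero_neq_numeral)
    then show ?thesis by (simp only: div_mult_self1 zero_neq_numeral add.commute)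
  qed
  have "(4 * k + 3) * t = 3 * t + k * (2 * t) * 2"
    by (simp add: add_mult_distrib)
  then have "(4 * k + 3) * t = (3 * r\<^sup>2 + r) div 2 + k * (r\<^sup>2 + r) * 2 + r"
    unfolding t[symmetric] e[symmetric] by simp
  then have "(q ^ (4 * k + 3)) ^ t = q ^ ((3 * r\<^sup>2 + r) div 2) * (q ^ (k * (r\<^sup>2 + r)))\<^sup>2 * q ^ r"
    unfolding power_mult[symmetric] by (simp only:) (simp only: power_add)
  moreover have "q ^ r * theta_diff q r = 1 - q ^ (2 * r + 1)"
    using assms by (simp add: theta_diff_def power_inverse right_diff_distrib mult_2 power_add)
  moreover have "s * X * d = s * E * (1 - u) * W" if "X = E * W * Y" "Y * d = 1 - u" for s X d E u W Y :: complex
    unfolding that(1) that(2)[symmetric] by (simp only: mult_ac)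
  ultimately show ?thesis
    unfolding theta_sign_def bailey_coeff_def t_def[symmetric] by blast
qed

lemma suminf_bailey_coeff:
  fixes q :: complex
  assumes q: "norm q < 1"
  shows "summable (\<lambda>r. norm (bailey_coeff q r * (q ^ (k * (r\<^sup>2 + r)))\<^sup>2))"
    and "(\<Sum>r. bailey_coeff q r * (q ^ (k * (r\<^sup>2 + r)))\<^sup>2) = (\<Prod>m. product_factor k q m) * qpoch_inf q q"
proof -
  show s: "summable (\<lambda>r. norm (bailey_coeff q r * (q ^ (k * (r\<^sup>2 + r)))\<^sup>2))"
  proof (rule summable_comparison_test[OF _ summable_norm_bailey_coeff[OF q]], intro exI allI impI)
    fix r
    have "norm ((q ^ (k * (r\<^sup>2 + r)))\<^sup>2) \<le> 1"
      using q by (simp add: norm_power power_le_one)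
    then show "norm (norm (bailey_coeff q r * (q ^ (k * (r\<^sup>2 + r)))\<^sup>2)) \<le> norm (bailey_coeff q r)"
      by (simp add: norm_mult mult_left_le)
  qed
  show "(\<Sum>r. bailey_coeff q r * (q ^ (k * (r\<^sup>2 + r)))\<^sup>2) = (\<Prod>m. product_factor k q m) * qpoch_inf q q"
  proof (cases "q = 0")
    \<comment> \<open>The triple product needs z = q to be non-zero. At q = 0 only r = 0
      contributes, and both sides are 1.\<close>
    case True
    have "(\<Sum>r. bailey_coeff q r * (q ^ (k * (r\<^sup>2 + r)))\<^sup>2) = (\<Sum>r\<in>{0}. bailey_coeff q r * (q ^ (k * (r\<^sup>2 + r)))\<^sup>2)"
    proof (rule suminf_finite)
      fix r :: nat assume "r \<notin> {0}"
      then have "q ^ ((3 * r\<^sup>2 + r) div 2) = 0"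
        unfolding bailey_coeff_exponent' by (simp add: True)
      then show "bailey_coeff q r * (q ^ (k * (r\<^sup>2 + r)))\<^sup>2 = 0"
        by (simp add: bailey_coeff_def)
    qed simp
    moreover have "product_factor k q = (\<lambda>_. 1)"
      by (auto simp: product_factor_def True fun_eq_iff power_0_left)
    ultimately show ?thesis
      by (simp add: True bailey_coeff_def qpoch_inf_def)
  next
    case False
    define M where "M = 4 * k + 3"
    have qM: "norm (q ^ M) < 1"
      using q by (simp add: M_def norm_power power_less_one_iff)
    have "q ^ M / q = q ^ (M - 1)"
      using False by (simp add: M_def power_add numeral_3_eq_3)
    then show ?thesis
      using triple_product[OF qM False] s prodinf_product_factor[OF M_def q]
      by (simp add: M_def theta_eq_bailey_coeff[OF False])
  qed
qed

subsection \<open>Sums over monotone tuples\<close>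

text \<open>The factors belonging to one chain alone; those in n_1 and l_1 are left to the
  kernels.\<close>

definition tuple_weight :: "nat \<Rightarrow> complex \<Rightarrow> (nat \<Rightarrow> nat) \<Rightarrow> complex" where
  "tuple_weight k q n = q ^ (\<Sum>i=1..k. (n i)\<^sup>2 + n i) / (\<Prod>i\<in>{1..<k}. qpoch q q (n (i + 1) - n i))"

lemma summand_eq:
  assumes q: "norm q < 1"
  shows "summand k q n l = (1 - q) * (tuple_weight k q n * tuple_weight k q l
           * (1 / (qpoch q q (n 1 + l 1 + 1) * qpoch q q (n 1) * qpoch q q (l 1))))"
proof -
  have "qpoch q q (n 1 + l 1 + 1) = (1 - q) * qpoch (q\<^sup>2) q (n 1 + l 1)"
    by (simp add: qpoch_shift power2_eq_square)
  moreover have "1 - q \<noteq> 0" using one_minus_power_nonzero[OF q, of 1] by simp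
  moreover have "(\<Sum>i=1..k. (n i)\<^sup>2) + (\<Sum>i=1..k. (l i)\<^sup>2) + (\<Sum>i=1..k. n i) + (\<Sum>i=1..k. l i)
      = (\<Sum>i=1..k. (n i)\<^sup>2 + n i) + (\<Sum>i=1..k. (l i)\<^sup>2 + l i)"
    by (simp add: sum.distrib)
  ultimately show ?thesis
    by (simp add: summand_def tuple_weight_def power_add)
qed

lemma tuple_weight_fun_upd:
  "tuple_weight (Suc (Suc k)) q (n(Suc (Suc k) := m))
     = q ^ (m\<^sup>2 + m) / qpoch q q (m - n (Suc k)) * tuple_weight (Suc k) q n"
proof -
  have "{1..<Suc (Suc k)} = insert (Suc k) {1..<Suc k}" by auto
  moreover have "(\<Prod>i\<in>{1..<Suc k}. qpoch q q ((n(Suc (Suc k) := m)) (i + 1) - (n(Suc (Suc k) := m)) i))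
      = (\<Prod>i\<in>{1..<Suc k}. qpoch q q (n (i + 1) - n i))"
    by (intro prod.cong) auto
  moreover have "(\<Sum>i=1..Suc k. ((n(Suc (Suc k) := m)) i)\<^sup>2 + (n(Suc (Suc k) := m)) i) = (\<Sum>i=1..Suc k. (n i)\<^sup>2 + n i)"
    by (intro sum.cong) auto
  ultimately show ?thesis
    unfolding tuple_weight_def sum.atLeast_Suc_atMost[OF le_refl] sum.cl_ivl_Suc
    by (simp add: power_add)
qed

text \<open>Fixing the largest entry makes the set finite, and m is exactly what the next link
  (q;q)_(m - n_k) of the chain depends on.\<close>

definition tuples_top :: "nat \<Rightarrow> nat \<Rightarrow> (nat \<Rightarrow> nat) set" where
  "tuples_top k m = {n \<in> tuples k. n k = m}"

lemma finite_tuples_top: "finite (tuples_top k m)"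
proof (rule finite_subset)
  show "tuples_top k m \<subseteq> PiE {1..k} (\<lambda>_. {..m})"
  proof
    fix n assume "n \<in> tuples_top k m"
    then have n: "n \<in> extensional {1..k}" "mono_on {1..k} n" "n k = m"
      by (auto simp: tuples_top_def tuples_def)
    have "n i \<le> m" if "i \<in> {1..k}" for i
      using mono_onD[OF n(2), of i k] that n(3) by auto
    then show "n \<in> PiE {1..k} (\<lambda>_. {..m})"
      using n(1) by (auto simp: PiE_def)
  qed
qed (auto intro: finite_PiE)

lemma tuples_1: "tuples_top (Suc 0) m = {\<lambda>i. if i = 1 then m else undefined}"
  by (auto simp: tuples_top_def tuples_def extensional_def mono_on_def fun_eq_iff)

text \<open>Resetting the removed entry to \<open>undefined\<close> restores extensionality, so that
  dropping and restoring the top entry are inverse to each other.\<close>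

lemma tuples_Suc:
  "n \<in> tuples (Suc (Suc k)) \<longleftrightarrow>
     n(Suc (Suc k) := undefined) \<in> tuples (Suc k) \<and> n (Suc k) \<le> n (Suc (Suc k))"
proof
  assume n: "n \<in> tuples (Suc (Suc k))"
  then have mono: "n i \<le> n j" if "1 \<le> i" "i \<le> j" "j \<le> Suc (Suc k)" for i j
    using that by (auto simp: tuples_def mono_on_def)
  show "n(Suc (Suc k) := undefined) \<in> tuples (Suc k) \<and> n (Suc k) \<le> n (Suc (Suc k))"
    using n mono by (auto simp: tuples_def extensional_def intro!: mono_onI)
next
  assume n: "n(Suc (Suc k) := undefined) \<in> tuples (Suc k) \<and> n (Suc k) \<le> n (Suc (Suc k))"
  then have mono: "n i \<le> n j" if "1 \<le> i" "i \<le> j" "j \<le> Suc k" for i j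
    using that mono_onD[of "{1..Suc k}" "n(Suc (Suc k) := undefined)" i j] by (auto simp: tuples_def)
  have "n i \<le> n j" if "1 \<le> i" "i \<le> j" "j \<le> Suc (Suc k)" for i j
  proof (cases "j = Suc (Suc k)")
    case True
    then show ?thesis
      using mono[of i "Suc k"] n that by (cases "i = j") (auto intro: order_trans)
  qed (use mono that in auto)
  moreover have "n i = undefined" if "i \<notin> {1..Suc (Suc k)}" for i
  proof -
    have ext: "n(Suc (Suc k) := undefined) \<in> extensional {1..Suc k}"
      using n by (simp add: tuples_def)
    have "(n(Suc (Suc k) := undefined)) i = undefined"
      by (rule extensional_arb[OF ext]) (use that in auto)
    then show ?thesis using that by (cases "i = Suc (Suc k)") auto
  qed
  ultimately show "n \<in> tuples (Suc (Suc k))"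
    by (auto simp: tuples_def extensional_def intro!: mono_onI)
qed

lemma sum_tuples_top_Suc:
  fixes f :: "(nat \<Rightarrow> nat) \<Rightarrow> complex"
  shows "(\<Sum>n\<in>tuples_top (Suc (Suc k)) m. f n)
           = (\<Sum>j\<le>m. \<Sum>n\<in>tuples_top (Suc k) j. f (n(Suc (Suc k) := m)))"
proof -
  have und: "n (Suc (Suc k)) = undefined" if "n \<in> tuples (Suc k)" for n
    using that by (auto simp: tuples_def extensional_def)
  then have upd: "n(Suc (Suc k) := undefined) = n" if "n \<in> tuples (Suc k)" for n
    using that by (simp add: fun_upd_idem)
  have "(\<Sum>j\<le>m. \<Sum>n\<in>tuples_top (Suc k) j. f (n(Suc (Suc k) := m)))
      = (\<Sum>(j, n)\<in>Sigma {..m} (tuples_top (Suc k)). f (n(Suc (Suc k) := m)))"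
    by (rule sum.Sigma) (auto simp: finite_tuples_top)
  also have "\<dots> = (\<Sum>n\<in>tuples_top (Suc (Suc k)) m. f n)"
    by (rule sum.reindex_bij_witness[of _ "\<lambda>n. (n (Suc k), n(Suc (Suc k) := undefined))"
          "\<lambda>(j, n). n(Suc (Suc k) := m)"])
       (auto simp: tuples_top_def tuples_Suc und upd)
  finally show ?thesis by simp
qed

text \<open>By induction the tuples with second largest entry j contribute a multiple of q^(j^2+j)
  times the kernel at j, and \<open>bailey_kernel_step\<close> sums over j. With k + 1 entries only
  k eigenvalues appear, because the top entry is not yet summed.\<close>

lemma tuple_weight_sum_top:
  assumes q: "norm q < 1"
  shows "(\<Sum>n\<in>tuples_top (Suc k) m. tuple_weight (Suc k) q n * bailey_kernel q (n 1) r)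
           = q ^ (m\<^sup>2 + m) * (q ^ (k * (r\<^sup>2 + r)) * bailey_kernel q m r)"
proof (induction k arbitrary: m)
  case 0
  show ?case by (simp add: tuples_1 tuple_weight_def)
next
  case (Suc k)
  have "(\<Sum>n\<in>tuples_top (Suc (Suc k)) m. tuple_weight (Suc (Suc k)) q n * bailey_kernel q (n 1) r)
      = (\<Sum>j\<le>m. q ^ (m\<^sup>2 + m) / qpoch q q (m - j)
          * (\<Sum>n\<in>tuples_top (Suc k) j. tuple_weight (Suc k) q n * bailey_kernel q (n 1) r))"
    unfolding sum_tuples_top_Suc tuple_weight_fun_upd sum_distrib_left
    by (intro sum.cong refl) (simp add: tuples_top_def)
  also have "\<dots> = q ^ (m\<^sup>2 + m) * q ^ (k * (r\<^sup>2 + r))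
      * (\<Sum>j\<le>m. q ^ (j\<^sup>2 + j) / qpoch q q (m - j) * bailey_kernel q j r)"
    unfolding Suc sum_distrib_left by (intro sum.cong refl) simp
  also have "\<dots> = q ^ (m\<^sup>2 + m) * (q ^ (Suc k * (r\<^sup>2 + r)) * bailey_kernel q m r)"
    unfolding bailey_kernel_step[OF q] by (simp add: power_add)
  finally show ?case .
qed

text \<open>A finite set of tuples lies in a box {0..N}^k, over which the sum factors into k partial
  geometric series.\<close>

lemma summable_on_tuples_geometric:
  fixes x :: real
  assumes "0 \<le> x" "x < 1"
  shows "(\<lambda>n. \<Prod>i=1..k. x ^ n i) summable_on tuples k"
proof (rule nonneg_bdd_above_summable_on)
  show "bdd_above (sum (\<lambda>n. \<Prod>i=1..k. x ^ n i) ` {F. F \<subseteq> tuples k \<and> finite F})"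
  proof (rule bdd_aboveI2)
    fix F assume "F \<in> {F. F \<subseteq> tuples k \<and> finite F}"
    then have F: "F \<subseteq> tuples k" "finite F" by auto
    define N where "N = Max (insert 0 (\<Union>n\<in>F. n ` {1..k}))"
    have "n i \<le> N" if "n \<in> F" "i \<in> {1..k}" for n i
      unfolding N_def
    proof (rule Max_ge)
      show "n i \<in> insert 0 (\<Union>n\<in>F. n ` {1..k})" using that by blast
    qed (use F(2) in auto)
    then have "F \<subseteq> PiE {1..k} (\<lambda>_. {..N})"
      using F(1) by (auto simp: PiE_def tuples_def)
    then have "(\<Sum>n\<in>F. \<Prod>i=1..k. x ^ n i) \<le> (\<Sum>n\<in>PiE {1..k} (\<lambda>_. {..N}). \<Prod>i=1..k. x ^ n i)"
      using assms by (intro sum_mono2 finite_PiE prod_nonneg) auto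
    also have "\<dots> = (\<Prod>i=1..k. \<Sum>j\<le>N. x ^ j)"
      by (rule prod_sum_PiE[symmetric]) auto
    also have "\<dots> \<le> (\<Prod>i=1..k. 1 / (1 - x))"
    proof (intro prod_mono conjI)
      show "0 \<le> (\<Sum>j\<le>N. x ^ j)" using assms by (intro sum_nonneg) auto
      have "(\<Sum>j\<le>N. x ^ j) \<le> (\<Sum>j. x ^ j)"
        using assms by (intro sum_le_suminf summable_geometric) auto
      also have "\<dots> = 1 / (1 - x)"
        using assms by (intro suminf_geometric) auto
      finally show "(\<Sum>j\<le>N. x ^ j) \<le> 1 / (1 - x)" .
    qed
    finally show "(\<Sum>n\<in>F. \<Prod>i=1..k. x ^ n i) \<le> (\<Prod>i=1..k. 1 / (1 - x))" .
  qed
qed (use assms in \<open>auto intro!: prod_nonneg\<close>)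

text \<open>Since n^2 + n >= n, the power of q is dominated by a product of geometric terms; each
  link is at most C.\<close>

lemma tuple_weight_abs_summable:
  assumes q: "norm q < 1"
  shows "(\<lambda>n. norm (tuple_weight k q n)) summable_on tuples k"
proof -
  obtain C where C: "C > 0" "\<And>n. norm (1 / qpoch q q n) \<le> C"
    using inverse_qpoch_q_bounded[OF q] by blast
  show ?thesis
  proof (rule Infinite_Sum.abs_summable_on_comparison_test')
    show "(\<lambda>n. (\<Prod>i=1..k. norm q ^ n i) * (\<Prod>i\<in>{1..<k}. C)) summable_on tuples k"
      using q by (intro summable_on_cmult_left summable_on_tuples_geometric) auto
    fix n
    have "norm (q ^ (\<Sum>i=1..k. (n i)\<^sup>2 + n i)) \<le> (\<Prod>i=1..k. norm q ^ n i)"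
      unfolding norm_power power_sum[symmetric]
      using q by (intro power_decreasing sum_mono) auto
    moreover have "norm (\<Prod>i\<in>{1..<k}. 1 / qpoch q q (n (i + 1) - n i)) \<le> (\<Prod>i\<in>{1..<k}. C)"
      unfolding prod_norm[symmetric] using C by (intro prod_mono) auto
    ultimately have "norm (q ^ (\<Sum>i=1..k. (n i)\<^sup>2 + n i)) * norm (\<Prod>i\<in>{1..<k}. 1 / qpoch q q (n (i + 1) - n i))
        \<le> (\<Prod>i=1..k. norm q ^ n i) * (\<Prod>i\<in>{1..<k}. C)"
      by (intro mult_mono prod_nonneg) auto
    then show "norm (tuple_weight k q n) \<le> (\<Prod>i=1..k. norm q ^ n i) * (\<Prod>i\<in>{1..<k}. C)"
      unfolding tuple_weight_def norm_mult[symmetric] by (simp add: prod_dividef)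
  qed
qed

lemma bailey_kernel_bounded:
  assumes q: "norm q < 1"
  obtains C where "C > 0" "\<And>n r. norm (bailey_kernel q n r) \<le> C"
proof -
  obtain C where C: "C > 0" "\<And>n. norm (1 / qpoch q q n) \<le> C"
    using inverse_qpoch_q_bounded[OF q] by blast
  have "norm (bailey_kernel q n r) \<le> C * C" for n r
  proof -
    have "norm (1 / qpoch q q (n - r)) * norm (1 / qpoch q q (n + r + 1)) \<le> C * C"
      using C by (intro mult_mono) (auto intro: less_imp_le)
    then show ?thesis
      using C(1) by (auto simp: bailey_kernel_def inverse_qpoch_diff_def norm_divide norm_mult)
  qed
  then show thesis using that[of "C * C"] C(1) by simp
qed

lemma tuple_weight_kernel_abs_summable:
  assumes q: "norm q < 1"
  shows "(\<lambda>n. norm (tuple_weight k q n * bailey_kernel q (n 1) r)) summable_on tuples k"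
proof -
  obtain C where C: "C > 0" "\<And>n r. norm (bailey_kernel q n r) \<le> C"
    using bailey_kernel_bounded[OF q] by blast
  have "norm (tuple_weight k q n * bailey_kernel q (n 1) r) \<le> norm (tuple_weight k q n) * C" for n
    unfolding norm_mult by (intro mult_left_mono C) simp
  then show ?thesis
    by (rule Infinite_Sum.abs_summable_on_comparison_test'[OF summable_on_cmult_left[OF tuple_weight_abs_summable[OF q]]])
qed

text \<open>Grouping the tuples by their top entry m leaves the series of
  \<open>bailey_kernel_has_sum\<close>, which supplies the last eigenvalue and the infinite
  product.\<close>

lemma tuple_weight_has_sum:
  assumes q: "norm q < 1"
  shows "((\<lambda>n. tuple_weight (Suc k) q n * bailey_kernel q (n 1) r) has_sum
           (q ^ (Suc k * (r\<^sup>2 + r)) / qpoch_inf q q)) (tuples (Suc k))"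
proof -
  define f where "f n = tuple_weight (Suc k) q n * bailey_kernel q (n 1) r" for n
  have bij: "bij_betw snd (Sigma UNIV (tuples_top (Suc k))) (tuples (Suc k))"
    by (rule bij_betwI[of _ _ _ "\<lambda>n. (n (Suc k), n)"]) (auto simp: tuples_top_def)
  have "f summable_on tuples (Suc k)"
    unfolding f_def by (rule abs_summable_summable[OF tuple_weight_kernel_abs_summable[OF q]])
  then have "(\<lambda>p. f (snd p)) summable_on Sigma UNIV (tuples_top (Suc k))"
    using summable_on_reindex_bij_betw[OF bij] by blast
  moreover have "((\<lambda>m. q ^ (k * (r\<^sup>2 + r)) * (q ^ (m\<^sup>2 + m) * bailey_kernel q m r)) has_sum
      (q ^ (k * (r\<^sup>2 + r)) * (q ^ (r\<^sup>2 + r) / qpoch_inf q q))) UNIV"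
    by (intro has_sum_cmult_right bailey_kernel_has_sum q)
  moreover have "((\<lambda>n. f (snd (m, n))) has_sum (q ^ (k * (r\<^sup>2 + r)) * (q ^ (m\<^sup>2 + m) * bailey_kernel q m r)))
      (tuples_top (Suc k) m)" for m
    using tuple_weight_sum_top[OF q]
    by (intro has_sum_finiteI finite_tuples_top) (simp add: f_def mult_ac)
  ultimately have "((\<lambda>p. f (snd p)) has_sum (q ^ (k * (r\<^sup>2 + r)) * (q ^ (r\<^sup>2 + r) / qpoch_inf q q)))
      (Sigma UNIV (tuples_top (Suc k)))"
    by (intro has_sum_SigmaI) auto
  then have "(f has_sum (q ^ (k * (r\<^sup>2 + r)) * (q ^ (r\<^sup>2 + r) / qpoch_inf q q))) (tuples (Suc k))"
    using has_sum_reindex_bij_betw[OF bij] by blast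
  then show ?thesis
    unfolding f_def by (simp add: power_add mult_ac)
qed

section \<open>Exchange of summations and the final identity\<close>

lemma summable_on_mult_nonneg:
  fixes g :: "'a \<Rightarrow> real" and h :: "'b \<Rightarrow> real"
  assumes "g summable_on A" "h summable_on B" "\<And>x. x \<in> A \<Longrightarrow> 0 \<le> g x" "\<And>y. y \<in> B \<Longrightarrow> 0 \<le> h y"
  shows "(\<lambda>(x, y). g x * h y) summable_on A \<times> B"
proof (rule summable_on_SigmaI)
  show "((\<lambda>y. case (x, y) of (x, y) \<Rightarrow> g x * h y) has_sum g x * infsum h B) B" for x
    using assms(2) by (auto intro: has_sum_cmult_right)
  show "(\<lambda>x. g x * infsum h B) summable_on A"
    using assms(1) by (rule summable_on_cmult_left)
qed (use assms in auto)

theorem mainTheorem16: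
  fixes k :: nat and q :: complex
  assumes "k \<ge> 1" and "norm q < 1"
  shows "((\<lambda>(n, l). summand k q n l) has_sum
           (1 / qpoch_inf (q\<^sup>2) q * (\<Prod>m. product_factor k q m))) (tuples k \<times> tuples k)"
proof -
  note q = assms(2)
  define P where "P = qpoch_inf q q"
  define J where "J = (\<Prod>m. product_factor k q m)"
  have P: "P \<noteq> 0" unfolding P_def by (rule qpoch_inf_q_nonzero[OF q])
  define f where "f r n = tuple_weight k q n * bailey_kernel q (n 1) r" for r n
  \<comment> \<open>Summed over (n, l) first, h yields the theta series; summed over r first, it
    yields the original summand divided by 1 - q.\<close>
  define h where "h = (\<lambda>(r, n, l). bailey_coeff q r * (f r n * f r l))"
  obtain C where C: "C > 0" "\<And>n r. norm (bailey_kernel q n r) \<le> C"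
    using bailey_kernel_bounded[OF q] by blast
  have f_le: "norm (f r n) \<le> C * norm (tuple_weight k q n)" for r n
  proof -
    have "norm (bailey_kernel q (n 1) r) * norm (tuple_weight k q n) \<le> C * norm (tuple_weight k q n)"
      by (intro mult_right_mono C) simp
    then show ?thesis by (simp add: f_def norm_mult mult.commute)
  qed
  have f_sum: "(f r has_sum (q ^ (k * (r\<^sup>2 + r)) / P)) (tuples k)" for r
  proof -
    obtain k' where "k = Suc k'" using assms(1) by (cases k) auto
    then show ?thesis
      using tuple_weight_has_sum[OF q, of k' r] unfolding f_def[abs_def] P_def by simp
  qed
  \<comment> \<open>The kernel bound C is uniform in r, so the majorant is a product of three
    functions, one for each of r, n and l.\<close>
  have summable: "h summable_on UNIV \<times> (tuples k \<times> tuples k)"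
  proof (rule abs_summable_summable, rule Infinite_Sum.abs_summable_on_comparison_test')
    have w: "(\<lambda>n. C * norm (tuple_weight k q n)) summable_on tuples k"
      by (intro summable_on_cmult_right tuple_weight_abs_summable q)
    have a: "(\<lambda>r. norm (bailey_coeff q r)) summable_on UNIV"
      using summable_norm_bailey_coeff[OF q] by (intro norm_summable_imp_summable_on) simp
    show "(\<lambda>(r, p). norm (bailey_coeff q r) * (\<lambda>(n, l). C * norm (tuple_weight k q n) * (C * norm (tuple_weight k q l))) p)
        summable_on UNIV \<times> (tuples k \<times> tuples k)"
      using C(1) by (intro summable_on_mult_nonneg a w) auto
    show "norm (h x) \<le> (\<lambda>(r, p). norm (bailey_coeff q r) * (\<lambda>(n, l). C * norm (tuple_weight k q n) * (C * norm (tuple_weight k q l))) p) x" for x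
      using C(1) unfolding h_def
      by (auto simp: norm_mult split: prod.split intro!: mult_left_mono mult_mono f_le)
  qed
  have pair: "((\<lambda>p. h (r, p)) has_sum (bailey_coeff q r * (q ^ (k * (r\<^sup>2 + r)))\<^sup>2 * (1 / (P * P)))) (tuples k \<times> tuples k)" for r
  proof (rule has_sum_SigmaI)
    show "((\<lambda>l. h (r, n, l)) has_sum (bailey_coeff q r * (f r n * (q ^ (k * (r\<^sup>2 + r)) / P)))) (tuples k)" for n
      unfolding h_def prod.case by (intro has_sum_cmult_right f_sum)
    have "((\<lambda>n. bailey_coeff q r * (f r n * (q ^ (k * (r\<^sup>2 + r)) / P))) has_sum
        (bailey_coeff q r * (q ^ (k * (r\<^sup>2 + r)) / P * (q ^ (k * (r\<^sup>2 + r)) / P)))) (tuples k)"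
      by (intro has_sum_cmult_right has_sum_cmult_left f_sum)
    then show "((\<lambda>n. bailey_coeff q r * (f r n * (q ^ (k * (r\<^sup>2 + r)) / P))) has_sum
        (bailey_coeff q r * (q ^ (k * (r\<^sup>2 + r)))\<^sup>2 * (1 / (P * P)))) (tuples k)"
      by (simp add: power2_eq_square)
    show "(\<lambda>p. h (r, p)) summable_on tuples k \<times> tuples k"
      using summable_on_SigmaD1[of "\<lambda>r p. h (r, p)" UNIV "\<lambda>_. tuples k \<times> tuples k" r] summable
      by simp
  qed
  have "((\<lambda>r. bailey_coeff q r * (q ^ (k * (r\<^sup>2 + r)))\<^sup>2) has_sum (J * P)) UNIV"
    unfolding J_def P_def suminf_bailey_coeff(2)[OF q, of k, symmetric]
    by (rule norm_summable_imp_has_sum[OF suminf_bailey_coeff(1)[OF q]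
          summable_sums[OF summable_norm_cancel[OF suminf_bailey_coeff(1)[OF q]]]])
  then have "((\<lambda>r. bailey_coeff q r * (q ^ (k * (r\<^sup>2 + r)))\<^sup>2 * (1 / (P * P))) has_sum (J * P * (1 / (P * P)))) UNIV"
    by (rule has_sum_cmult_left)
  then have "(h has_sum (J * P * (1 / (P * P)))) (UNIV \<times> (tuples k \<times> tuples k))"
    by (rule has_sum_SigmaI[OF pair _ summable])
  then have "((\<lambda>(p, r). h (r, p)) has_sum (J / P)) ((tuples k \<times> tuples k) \<times> UNIV)"
    using P by (subst (asm) has_sum_swap) simp
  \<comment> \<open>For fixed (n, l) the series over r stops at r = l_1, where
    \<open>bailey_unit_pair\<close> evaluates it.\<close>
  moreover have "((\<lambda>r. (\<lambda>(p, r). h (r, p)) (p, r)) has_sum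
      (\<lambda>(n, l). tuple_weight k q n * tuple_weight k q l * (1 / (qpoch q q (n 1 + l 1 + 1) * qpoch q q (n 1) * qpoch q q (l 1)))) p) UNIV" for p
  proof (cases p)
    case (Pair n l)
    have "((\<lambda>r. bailey_coeff q r * bailey_kernel q (n 1) r * bailey_kernel q (l 1) r) has_sum
        (1 / (qpoch q q (n 1 + l 1 + 1) * qpoch q q (n 1) * qpoch q q (l 1)))) UNIV"
      unfolding bailey_unit_pair[OF q, symmetric]
      by (rule has_sum_finite_neutralI[of "{..l 1}"]) (auto simp: bailey_kernel_eq_0)
    then have "((\<lambda>r. tuple_weight k q n * tuple_weight k q l * (bailey_coeff q r * bailey_kernel q (n 1) r * bailey_kernel q (l 1) r)) has_sum
        (tuple_weight k q n * tuple_weight k q l * (1 / (qpoch q q (n 1 + l 1 + 1) * qpoch q q (n 1) * qpoch q q (l 1))))) UNIV"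
      by (rule has_sum_cmult_right)
    then show ?thesis
      by (simp add: Pair h_def f_def mult_ac)
  qed
  ultimately have "((\<lambda>(n, l). tuple_weight k q n * tuple_weight k q l * (1 / (qpoch q q (n 1 + l 1 + 1) * qpoch q q (n 1) * qpoch q q (l 1))))
      has_sum (J / P)) (tuples k \<times> tuples k)"
    by (rule has_sum_SigmaD)
  then have "((\<lambda>p. (1 - q) * (\<lambda>(n, l). tuple_weight k q n * tuple_weight k q l * (1 / (qpoch q q (n 1 + l 1 + 1) * qpoch q q (n 1) * qpoch q q (l 1)))) p)
      has_sum ((1 - q) * (J / P))) (tuples k \<times> tuples k)"
    by (rule has_sum_cmult_right)
  moreover have "(\<lambda>p. (1 - q) * (\<lambda>(n, l). tuple_weight k q n * tuple_weight k q l * (1 / (qpoch q q (n 1 + l 1 + 1) * qpoch q q (n 1) * qpoch q q (l 1)))) p)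
      = (\<lambda>(n, l). summand k q n l)"
    by (auto simp: fun_eq_iff summand_eq[OF q])
  moreover have "P = (1 - q) * qpoch_inf (q\<^sup>2) q"
  proof (rule LIMSEQ_unique)
    show "(\<lambda>n. qpoch q q (Suc n)) \<longlonglongrightarrow> P"
      unfolding P_def by (intro LIMSEQ_Suc qpoch_tendsto q)
    show "(\<lambda>n. qpoch q q (Suc n)) \<longlonglongrightarrow> (1 - q) * qpoch_inf (q\<^sup>2) q"
      unfolding qpoch_shift power2_eq_square by (intro tendsto_intros qpoch_tendsto q)
  qed
  ultimately show ?thesis
    using P by (simp add: J_def)
qed

end
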